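(* Let $r\in\{1,2,4\}$ and let $k\geq 1$ be an integer. Then: 1. the Lie algebras $\mathcal N_{r,r+8k}$ and $\mathcal N_{r+8k,r}$ are isomorphic; 2. the Lie algebra $\mathcal N_{r+4k,r+4k}$ admits a Lie algebra automorphism $\Psi=A\oplus C$ with $CC^{\tau}=-\mathrm{Id}$.
   Context: $\mathbb R^{r,s}$ denotes $\mathbb R^{r+s}$ with the symmetric bilinear form $\langle x,y\rangle_{r,s}=\sum_{i=1}^r x_iy_i-\sum_{j=1}^s x_{r+j}y_{r+j}$, and $\mathrm{Cl}_{r,s}$ is the Clifford algebra it generates with the convention $x\otimes x=-\langle x,x\rangle_{r,s}$. A $\mathrm{Cl}_{r,s}$-module is a finite-dimensional real vector space $U$ with a linear map $J\colon\mathbb R^{r,s}\to\mathrm{End}(U)$ such that $J_z^2=-\langle z,z\rangle_{r,s}\mathrm{Id}_U$. It is admissible if equipped with a non-degenerate symmetric bilinear form $\langle\cdot,\cdot\rangle_U$ with $\langle J_zx,y\rangle_U+\langle x,J_zy\rangle_U=0$ for all $z,x,y$; minimal admissible (denoted $V^{r,s}$) means (nonzero) admissible of the smallest possible dimension. $\mathcal N_{r,s}(U)=U\oplus\mathbb R^{r,s}$ is the 2-step nilpotent Lie algebra with centre $\mathbb R^{r,s}$ and bracket $[U,U]\subset\mathbb R^{r,s}$ given by $\langle J_zx,y\rangle_U=\langle z,[x,y]\rangle_{r,s}$. One writes $\mathcal N_{r,s}=\mathcal N_{r,s}(V^{r,s})$; up to isomorphism this does not depend on the choice of the minimal admissible module.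 $A\oplus C$ denotes the block diagonal map $(x,z)\mapsto(A(x),C(z))$ with $A$ a linear map of the module part and $C$ a linear map of the centre, and $C^{\tau}$ is the adjoint of $C$ with respect to the scalar product of the centre. *)

theory Defs
  imports "HOL-Analysis.Analysis" "HOL-Analysis.Finite_Function_Topology"
begin

section \<open>Linear maps on subspaces\<close>

text \<open>
  All vector spaces are subspaces of types of class \<^class>\<open>real_vector\<close>.  Maps are
  total functions, but nothing is ever required of their values outside the given subspace.
\<close>

definition linear_on :: "'a::real_vector set \<Rightarrow> ('a \<Rightarrow> 'b::real_vector) \<Rightarrow> bool" where
  "linear_on S f \<longleftrightarrow>
     (\<forall>x\<in>S. \<forall>y\<in>S. f (x + y) = f x + f y) \<and> (\<forall>c. \<forall>x\<in>S. f (c *\<^sub>R x) = c *\<^sub>R f x)"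

definition linear_endo_on :: "'a::real_vector set \<Rightarrow> ('a \<Rightarrow> 'a) \<Rightarrow> bool" where
  "linear_endo_on S f \<longleftrightarrow> linear_on S f \<and> f ` S \<subseteq> S"

definition finite_dim_subspace :: "'a::real_vector set \<Rightarrow> bool" where
  "finite_dim_subspace U \<longleftrightarrow> subspace U \<and> (\<exists>B. finite B \<and> span B = U)"

section \<open>The spaces \<open>\<real>\<^sup>r\<^sup>,\<^sup>s\<close>\<close>

text \<open>
  The signature has to be a pair of natural numbers, so the coordinate spaces of all
  dimensions are realised inside the finitely supported sequences: a vector of
  \<open>Rspace r s\<close> is supported on the indices \<open>0, \<dots>, r + s - 1\<close>, so that coordinates are
  counted from 0.
\<close>

type_synonym coords = "(nat, real) poly_mapping"

definition Rspace :: "nat \<Rightarrow> nat \<Rightarrow> coords set" where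
  "Rspace r s = {z. Poly_Mapping.keys z \<subseteq> {..<r + s}}"

definition sp :: "nat \<Rightarrow> nat \<Rightarrow> coords \<Rightarrow> coords \<Rightarrow> real" where
  "sp r s x y =
     (\<Sum>i<r. Poly_Mapping.lookup x i * Poly_Mapping.lookup y i) -
     (\<Sum>j<s. Poly_Mapping.lookup x (r + j) * Poly_Mapping.lookup y (r + j))"

text \<open>\<open>D\<close> is the adjoint of \<open>C\<close>; it is unique because \<open>sp r s\<close> is non-degenerate.\<close>

definition is_sp_adjoint :: "nat \<Rightarrow> nat \<Rightarrow> (coords \<Rightarrow> coords) \<Rightarrow> (coords \<Rightarrow> coords) \<Rightarrow> bool" where
  "is_sp_adjoint r s C D \<longleftrightarrow>
     linear_endo_on (Rspace r s) D \<and>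
     (\<forall>z\<in>Rspace r s. \<forall>w\<in>Rspace r s. sp r s (C z) w = sp r s z (D w))"

section \<open>Admissible Clifford modules\<close>

definition clifford_module ::
    "nat \<Rightarrow> nat \<Rightarrow> 'u::real_vector set \<Rightarrow> (coords \<Rightarrow> 'u \<Rightarrow> 'u) \<Rightarrow> bool" where
  "clifford_module r s U J \<longleftrightarrow>
     finite_dim_subspace U \<and>
     (\<forall>z\<in>Rspace r s. linear_endo_on U (J z)) \<and>
     (\<forall>x\<in>U. linear_on (Rspace r s) (\<lambda>z. J z x)) \<and>
     (\<forall>z\<in>Rspace r s. \<forall>x\<in>U. J z (J z x) = - (sp r s z z *\<^sub>R x))"

definition scalar_product_on :: "'u::real_vector set \<Rightarrow> ('u \<Rightarrow> 'u \<Rightarrow> real) \<Rightarrow> bool" where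
  "scalar_product_on U b \<longleftrightarrow>
     (\<forall>y\<in>U. linear_on U (\<lambda>x. b x y)) \<and>
     (\<forall>x\<in>U. linear_on U (\<lambda>y. b x y)) \<and>
     (\<forall>x\<in>U. \<forall>y\<in>U. b x y = b y x) \<and>
     (\<forall>x\<in>U. (\<forall>y\<in>U. b x y = 0) \<longrightarrow> x = 0)"

definition admissible_module ::
    "nat \<Rightarrow> nat \<Rightarrow> 'u::real_vector set \<Rightarrow> (coords \<Rightarrow> 'u \<Rightarrow> 'u) \<Rightarrow> ('u \<Rightarrow> 'u \<Rightarrow> real) \<Rightarrow> bool" where
  "admissible_module r s U J b \<longleftrightarrow>
     clifford_module r s U J \<and> scalar_product_on U b \<and>
     (\<forall>z\<in>Rspace r s. \<forall>x\<in>U. \<forall>y\<in>U. b (J z x) y + b x (J z y) = 0)"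

text \<open>
  The competing modules \<open>U'\<close> range over subspaces of the same type as \<open>U\<close>.  This is no
  restriction, because a module of smaller dimension on any other space can be transported
  to a subspace of \<open>U\<close>: see \<open>minimal_admissible_le\<close> below.
\<close>

definition minimal_admissible ::
    "nat \<Rightarrow> nat \<Rightarrow> 'u::real_vector set \<Rightarrow> (coords \<Rightarrow> 'u \<Rightarrow> 'u) \<Rightarrow> ('u \<Rightarrow> 'u \<Rightarrow> real) \<Rightarrow> bool" where
  "minimal_admissible r s U J b \<longleftrightarrow>
     admissible_module r s U J b \<and> U \<noteq> {0} \<and>
     (\<forall>(U'::'u set) J' b'. admissible_module r s U' J' b' \<and> U' \<noteq> {0} \<longrightarrow> dim U \<le> dim U')"

lemma minimal_admissible_le:
  fixes U :: "'u::real_vector set" and V :: "'v::real_vector set"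
  assumes U: "minimal_admissible r s U J b"
    and V: "admissible_module r s V J' b'" "V \<noteq> {0}"
  shows "dim U \<le> dim V"
proof (rule ccontr)
  assume less: "\<not> dim U \<le> dim V"
  have sV: "subspace V" and sU: "subspace U"
    using U V by (auto simp: minimal_admissible_def admissible_module_def clifford_module_def
        finite_dim_subspace_def)
  obtain F where F: "finite F" "span F = V"
    using V by (auto simp: admissible_module_def clifford_module_def finite_dim_subspace_def)
  obtain G where G: "finite G" "span G = U"
    using U by (auto simp: minimal_admissible_def admissible_module_def clifford_module_def
        finite_dim_subspace_def)
  obtain B where B: "B \<subseteq> V" "independent B" "V \<subseteq> span B" "card B = dim V"
    using basis_exists by blast
  obtain E where E: "E \<subseteq> U" "independent E" "U \<subseteq> span E" "card E = dim U"
    using basis_exists by blast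
  have fB: "finite B" using B F by (metis independent_span_bound)
  have fE: "finite E" using E G by (metis independent_span_bound)
  obtain C where C: "C \<subseteq> E" "card C = card B" "finite C"
    using less B(4) E(4) obtain_subset_with_card_n[of "card B" E] by (metis nat_le_linear)
  obtain h where h: "bij_betw h B C"
    using fB C by (metis finite_same_card_bij)
  obtain g where g: "linear g" "\<forall>x\<in>B. g x = h x"
    using linear_independent_extend[OF B(2)] by blast
  have gB: "g ` B = C" using h g by (auto simp: bij_betw_def)
  have spB: "span B = V" using B sV by (metis span_subspace)
  have injB: "inj_on g B" using h g by (metis bij_betw_def inj_on_cong)
  have "independent (g ` B)" using gB C E by (metis independent_mono)
  then have inj: "inj_on g V"
    using linear_inj_on_span_iff_independent_image[OF g(1), of B] injB spB
    by simp
  obtain k where k: "linear k" "\<forall>v\<in>V. k (g v) = v"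
    using linear_exists_left_inverse_on[OF g(1) sV inj] by blast
  define S where "S = g ` V"
  define K where "K = (\<lambda>z u. g (J' z (k u)))"
  define c where "c = (\<lambda>u v. b' (k u) (k v))"
  have S: "subspace S" unfolding S_def using g(1) sV by (rule linear_subspace_image)
  have spC: "span C = S" using gB spB g(1) S_def by (metis linear_span_image)
  have fS: "finite_dim_subspace S"
    unfolding finite_dim_subspace_def using S spC C(3) by blast
  have kg [simp]: "k (x + y) = k x + k y" "k (a *\<^sub>R x) = a *\<^sub>R k x"
    "g (x' + y') = g x' + g y'" "g (a *\<^sub>R x') = a *\<^sub>R g x'" "g (- x') = - g x'"
    for x y a x' y'
    using g(1) k(1) by (simp_all add: linear_add linear_scale linear_neg)
  have kS: "k u \<in> V" "g (k u) = u" if "u \<in> S" for u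
    using that k(2) by (auto simp: S_def)
  have gV: "g v \<in> S" "k (g v) = v" if "v \<in> V" for v
    using that k(2) by (auto simp: S_def)
  have closed: "\<And>x y. x \<in> S \<Longrightarrow> y \<in> S \<Longrightarrow> x + y \<in> S" "\<And>a x. x \<in> S \<Longrightarrow> a *\<^sub>R x \<in> S"
    using S by (auto simp: subspace_add subspace_scale)
  have cl: "clifford_module r s V J'" and sc: "scalar_product_on V b'"
    and skew: "\<And>z x y. z \<in> Rspace r s \<Longrightarrow> x \<in> V \<Longrightarrow> y \<in> V \<Longrightarrow> b' (J' z x) y + b' x (J' z y) = 0"
    using V(1) by (simp_all add: admissible_module_def)
  have JV: "J' z v \<in> V" if "z \<in> Rspace r s" "v \<in> V" for z v
    using that cl by (auto simp: clifford_module_def linear_endo_on_def)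
  have J2: "J' z (J' z v) = - (sp r s z z *\<^sub>R v)" if "z \<in> Rspace r s" "v \<in> V" for z v
    using that cl by (simp add: clifford_module_def)
  have Jlin: "linear_on V (J' z)" if "z \<in> Rspace r s" for z
    using that cl by (simp add: clifford_module_def linear_endo_on_def)
  have Jlin2: "linear_on (Rspace r s) (\<lambda>z. J' z v)" if "v \<in> V" for v
    using that cl by (simp add: clifford_module_def)
  have bl: "y \<in> V \<Longrightarrow> linear_on V (\<lambda>x. b' x y)" "x \<in> V \<Longrightarrow> linear_on V (\<lambda>y. b' x y)" for x y
    using sc by (simp_all add: scalar_product_on_def)
  have sym': "b' x y = b' y x" if "x \<in> V" "y \<in> V" for x y
    using sc[unfolded scalar_product_on_def, THEN conjunct2, THEN conjunct2, THEN conjunct1] that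
    by blast
  have nondeg: "x = 0" if "x \<in> V" "\<And>y. y \<in> V \<Longrightarrow> b' x y = 0" for x
    using sc[unfolded scalar_product_on_def, THEN conjunct2, THEN conjunct2, THEN conjunct2] that
    by blast
  have "clifford_module r s S K"
    unfolding clifford_module_def
  proof (intro conjI ballI)
    show "linear_endo_on S (K z)" if z: "z \<in> Rspace r s" for z
      unfolding linear_endo_on_def linear_on_def K_def
      using Jlin[OF z, unfolded linear_on_def] kS(1) JV[OF z] gV(1) by auto
    show "linear_on (Rspace r s) (\<lambda>z. K z x)" if "x \<in> S" for x
      using Jlin2[OF kS(1)[OF that]] unfolding linear_on_def K_def by simp
    show "K z (K z x) = - (sp r s z z *\<^sub>R x)" if "z \<in> Rspace r s" "x \<in> S" for z x
      unfolding K_def using that by (simp add: gV JV kS J2)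
  qed (rule fS)
  moreover have "scalar_product_on S c"
    unfolding scalar_product_on_def
  proof (intro conjI ballI impI)
    show "linear_on S (\<lambda>x. c x y)" if "y \<in> S" for y
      using bl(1)[OF kS(1)[OF that]] unfolding linear_on_def c_def by (simp add: kS)
    show "linear_on S (\<lambda>y. c x y)" if "x \<in> S" for x
      using bl(2)[OF kS(1)[OF that]] unfolding linear_on_def c_def by (simp add: kS)
    show "c x y = c y x" if "x \<in> S" "y \<in> S" for x y
      unfolding c_def using that by (intro sym' kS)
    show "x = 0" if x: "x \<in> S" "\<forall>y\<in>S. c x y = 0" for x
    proof -
      have "b' (k x) v = 0" if "v \<in> V" for v
        using x(2) gV[OF that] by (auto simp: c_def)
      then have "k x = 0" by (intro nondeg kS(1)[OF x(1)])
      then show ?thesis using kS(2)[OF x(1)] g(1) by (metis linear_0)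
    qed
  qed
  moreover have "\<forall>z\<in>Rspace r s. \<forall>x\<in>S. \<forall>y\<in>S. c (K z x) y + c x (K z y) = 0"
    using skew by (simp add: c_def K_def gV JV kS)
  ultimately have "admissible_module r s S K c"
    by (simp add: admissible_module_def)
  moreover have "S \<noteq> {0}"
  proof
    assume "S = {0}"
    then have "v = 0" if "v \<in> V" for v
      using gV[OF that] k(1) linear_0 by fastforce
    then show False using V(2) subspace_0[OF sV] by blast
  qed
  ultimately have "dim U \<le> dim S"
    using U unfolding minimal_admissible_def by blast
  also have "dim S \<le> dim V"
    using spC C B(4) dim_le_card[of S C] by simp
  finally show False using less by simp
qed

section \<open>Pseudo \<open>H\<close>-type Lie algebras\<close>

record 'a lie_algebra =
  lie_space :: "'a set"
  lie_bracket :: "'a \<Rightarrow> 'a \<Rightarrow> 'a"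

definition lie_isomorphism ::
    "'a::real_vector lie_algebra \<Rightarrow> 'b::real_vector lie_algebra \<Rightarrow> ('a \<Rightarrow> 'b) \<Rightarrow> bool" where
  "lie_isomorphism L M f \<longleftrightarrow>
     linear_on (lie_space L) f \<and> bij_betw f (lie_space L) (lie_space M) \<and>
     (\<forall>x\<in>lie_space L. \<forall>y\<in>lie_space L. f (lie_bracket L x y) = lie_bracket M (f x) (f y))"

definition lie_isomorphic :: "'a::real_vector lie_algebra \<Rightarrow> 'b::real_vector lie_algebra \<Rightarrow> bool" where
  "lie_isomorphic L M \<longleftrightarrow> (\<exists>f. lie_isomorphism L M f)"

definition lie_automorphism :: "'a::real_vector lie_algebra \<Rightarrow> ('a \<Rightarrow> 'a) \<Rightarrow> bool" where
  "lie_automorphism L f \<longleftrightarrow> lie_isomorphism L L f"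

text \<open>Existence and uniqueness of this vector are \<open>module_bracket_ex1\<close> below.\<close>

definition module_bracket ::
    "nat \<Rightarrow> nat \<Rightarrow> (coords \<Rightarrow> 'u \<Rightarrow> 'u) \<Rightarrow> ('u \<Rightarrow> 'u \<Rightarrow> real) \<Rightarrow> 'u \<Rightarrow> 'u \<Rightarrow> coords" where
  "module_bracket r s J b x y =
     (THE v. v \<in> Rspace r s \<and> (\<forall>z\<in>Rspace r s. b (J z x) y = sp r s z v))"

definition pseudo_H ::
    "nat \<Rightarrow> nat \<Rightarrow> 'u::real_vector set \<Rightarrow> (coords \<Rightarrow> 'u \<Rightarrow> 'u) \<Rightarrow> ('u \<Rightarrow> 'u \<Rightarrow> real)
      \<Rightarrow> ('u \<times> coords) lie_algebra" where
  "pseudo_H r s U J b =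
     \<lparr>lie_space = U \<times> Rspace r s,
      lie_bracket = (\<lambda>(x, z) (y, w). (0, module_bracket r s J b x y))\<rparr>"

lemma linear_on_sum:
  assumes "linear_on S f" "subspace S" "finite I" "\<And>i. i \<in> I \<Longrightarrow> v i \<in> S"
  shows "f (\<Sum>i\<in>I. c i *\<^sub>R v i) = (\<Sum>i\<in>I. c i *\<^sub>R f (v i))"
  using assms(3,4)
proof (induction I rule: finite_induct)
  case empty
  have "f (0 *\<^sub>R 0) = 0 *\<^sub>R f 0" using assms subspace_0 unfolding linear_on_def by blast
  then show ?case by simp
next
  case (insert i I)
  have "(\<Sum>i\<in>I. c i *\<^sub>R v i) \<in> S" "c i *\<^sub>R v i \<in> S"
    using insert assms(2) by (auto intro: subspace_sum subspace_scale)
  then show ?case using insert assms(1) by (simp add: linear_on_def)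
qed

lemma lookup_scaleR_coords:
  "Poly_Mapping.lookup (c *\<^sub>R (z::coords)) i = c * Poly_Mapping.lookup z i"
proof -
  have "finite {i. c * Poly_Mapping.lookup z i \<noteq> 0}"
    by (rule finite_subset[OF _ finite_keys[of z]]) (auto simp: in_keys_iff)
  then show ?thesis by (simp add: scaleR_poly_mapping_def)
qed

lemma subspace_Rspace: "subspace (Rspace r s)"
  unfolding subspace_def Rspace_def
  by (auto simp: in_keys_iff subset_iff lookup_add lookup_scaleR_coords) (metis add.right_neutral)

lemma Rspace_expand:
  assumes "z \<in> Rspace r s"
  shows "z = (\<Sum>i<r + s. Poly_Mapping.lookup z i *\<^sub>R Poly_Mapping.single i 1)"
proof (rule poly_mapping_eqI)
  fix k
  have "Poly_Mapping.lookup (\<Sum>i<r + s. Poly_Mapping.lookup z i *\<^sub>R Poly_Mapping.single i (1::real)) k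
      = (\<Sum>i<r + s. if k = i then Poly_Mapping.lookup z i else 0)"
    unfolding lookup_sum
    by (intro sum.cong) (auto simp: lookup_scaleR_coords lookup_single when_def)
  also have "\<dots> = Poly_Mapping.lookup z k"
    using assms by (auto simp: Rspace_def in_keys_iff subset_iff)
  finally show "Poly_Mapping.lookup z k = Poly_Mapping.lookup
      (\<Sum>i<r + s. Poly_Mapping.lookup z i *\<^sub>R Poly_Mapping.single i (1::real)) k" by simp
qed

lemma single_in_Rspace: "i < r + s \<Longrightarrow> Poly_Mapping.single i 1 \<in> Rspace r s"
  by (auto simp: Rspace_def)

lemma sp_eq:
  "sp r s x y = (\<Sum>i<r + s. Poly_Mapping.lookup x i *
     ((if i < r then 1 else -1) * Poly_Mapping.lookup y i))"
proof -
  have "(\<Sum>i<r + s. g i) = (\<Sum>i<r. g i) + (\<Sum>j<s. g (r + j))" for g :: "nat \<Rightarrow> real"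
    by (induction s) auto
  then show ?thesis by (simp add: sp_def sum_negf)
qed

lemma module_bracket_ex1:
  assumes "admissible_module r s U J b" "x \<in> U" "y \<in> U"
  shows "\<exists>!v. v \<in> Rspace r s \<and> (\<forall>z\<in>Rspace r s. b (J z x) y = sp r s z v)"
proof -
  let ?f = "\<lambda>z. b (J z x) y"
  let ?e = "\<lambda>i. if i < r then 1 else (-1::real)"
  let ?v = "\<Sum>i<r + s. (?e i * ?f (Poly_Mapping.single i 1)) *\<^sub>R Poly_Mapping.single i (1::real)"
  have lin: "linear_on (Rspace r s) ?f"
    using assms unfolding admissible_module_def clifford_module_def scalar_product_on_def
      linear_endo_on_def linear_on_def by (auto simp: image_subset_iff)
  have lv: "Poly_Mapping.lookup ?v k = (if k < r + s then ?e k * ?f (Poly_Mapping.single k 1) else 0)"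
    for k
  proof -
    have "Poly_Mapping.lookup ?v k =
        (\<Sum>i<r + s. if k = i then ?e i * ?f (Poly_Mapping.single i 1) else 0)"
      unfolding lookup_sum by (intro sum.cong) (auto simp: lookup_scaleR_coords lookup_single when_def)
    then show ?thesis by auto
  qed
  have "?v \<in> Rspace r s"
    by (intro subspace_sum subspace_scale subspace_Rspace single_in_Rspace) auto
  moreover have "?f z = sp r s z ?v" if z: "z \<in> Rspace r s" for z
  proof -
    have "?f z = (\<Sum>i<r + s. Poly_Mapping.lookup z i *\<^sub>R ?f (Poly_Mapping.single i 1))"
      using linear_on_sum[OF lin subspace_Rspace, of "{..<r + s}" "\<lambda>i. Poly_Mapping.single i 1"
          "Poly_Mapping.lookup z"] Rspace_expand[OF z] single_in_Rspace by auto
    also have "\<dots> = sp r s z ?v"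
      unfolding sp_eq by (intro sum.cong) (auto simp: lv)
    finally show ?thesis .
  qed
  moreover have "v = w" if v: "v \<in> Rspace r s" "\<forall>z\<in>Rspace r s. ?f z = sp r s z v"
    and w: "w \<in> Rspace r s" "\<forall>z\<in>Rspace r s. ?f z = sp r s z w" for v w
  proof (rule poly_mapping_eqI)
    fix k
    show "Poly_Mapping.lookup v k = Poly_Mapping.lookup w k"
    proof (cases "k < r + s")
      case True
      have *: "sp r s (Poly_Mapping.single k 1) u = ?e k * Poly_Mapping.lookup u k" for u
      proof -
        have "sp r s (Poly_Mapping.single k 1) u =
            (\<Sum>i<r + s. if k = i then ?e i * Poly_Mapping.lookup u i else 0)"
          unfolding sp_eq by (intro sum.cong) (auto simp: lookup_single when_def)
        then show ?thesis using True by auto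
      qed
      have "sp r s (Poly_Mapping.single k 1) v = sp r s (Poly_Mapping.single k 1) w"
        using v w single_in_Rspace[OF True] by metis
      then show ?thesis unfolding * by (auto split: if_splits)
    next
      case False
      then have "k \<notin> Poly_Mapping.keys v" "k \<notin> Poly_Mapping.keys w"
        using v(1) w(1) by (auto simp: Rspace_def)
      then show ?thesis by (simp add: in_keys_iff)
    qed
  qed
  ultimately show ?thesis by blast
qed

end

theory Submission
  imports Defs
begin

text \<open>
  In all cases \<open>r + s = 2 m\<close> with \<open>r - s\<close> divisible by 8, where \<open>m mod 4 \<noteq> 3\<close>, and twisting by a product
  of \<open>4 k\<close> generators with squares of the same sign reduces to neutral signature.  There, a
  module is generated by vacuum vectors; all its scalar products are determined by the pairing
  \<open>\<beta>\<close> of the vacua with the image of the vacua under the product of the \<open>m\<close> generators of square \<open>-1\<close>.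
  This pairing is symmetric if \<open>m mod 4 \<in> {0, 3}\<close> and alternating otherwise, so a minimal module is
  generated by one vacuum, respectively by a hyperbolic pair of vacua, and is unique up to the
  sign of the form.  If \<open>m mod 4 \<noteq> 3\<close>, the generators anticommute with some self-adjoint
  involution \<open>T\<close>.  Then the maps \<open>T J\<^sub>z\<close> and the form
  \<open>\<langle>T x, y\<rangle>\<close> are an admissible module of the opposite signature, with
  \<open>\<langle>T (T J\<^sub>z x), y\<rangle> = \<langle>J\<^sub>z x, y\<rangle>\<close>.  Uniqueness identifies it with the given module of the opposite
  signature, which yields both claims, the map of the centre being an anti-isometry.
\<close>

section \<open>Symmetric forms\<close>

text \<open>The exclusion of \<open>m mod 4 = 3\<close> comes from the involution \<open>T\<close>.
  It preserves the vacua and anticommutes with each of the \<open>m\<close> factors inside \<beta>,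
  so being an isometry it multiplies \<beta> by \<open>(-1) ^ m\<close>. This sign is 1 if
  \<open>m mod 4 = 0\<close>, and an alternating \<beta> absorbs it by rescaling one vector of a
  hyperbolic pair. For \<open>m mod 4 = 3\<close> the pairing is symmetric and \<open>m\<close> is
  odd, so a vacuum \<open>u\<close> with \<open>T u = t u\<close> and nonzero \<beta> u u would need
  t^2 = -1. The values 1, 2, 4 of \<open>r\<close> give the three other residues of
  \<open>m = r + 4 k\<close>.

  The sign that uniqueness leaves in the form is harmless: the bracket is linear in the form, so the
  sign moves into the map of the centre, where it only enters squared.

  The obstacle in undoing the twist is that uniqueness is applied to the twisted modules, so the map
  obtained must still be shown to intertwine the two twisting products. Composing with
  \<open>T\<close> changes a product of two generators only by a sign, so products of
  \<open>4 k\<close> generators are unchanged.\<close>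

definition nondegenerate_on :: "'u::real_vector set \<Rightarrow> ('u \<Rightarrow> 'u \<Rightarrow> real) \<Rightarrow> bool" where
  "nondegenerate_on U b \<longleftrightarrow> (\<forall>x\<in>U. (\<forall>y\<in>U. b x y = 0) \<longrightarrow> x = 0)"

lemma linear_onD:
  assumes "linear_on S f"
  shows "x \<in> S \<Longrightarrow> y \<in> S \<Longrightarrow> f (x + y) = f x + f y" "x \<in> S \<Longrightarrow> f (c *\<^sub>R x) = c *\<^sub>R f x"
  using assms by (auto simp: linear_on_def)

lemma linear_on_subset: "linear_on S f \<Longrightarrow> T \<subseteq> S \<Longrightarrow> linear_on T f"
  unfolding linear_on_def by blast

lemma linear_on_eq_on_span:
  assumes f: "linear_on S f" and g: "linear_on S g" and S: "subspace S" "S = span B"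
    and eq: "\<And>x. x \<in> B \<Longrightarrow> f x = g x" and x: "x \<in> S"
  shows "f x = g x"
proof -
  have "x \<in> span B" using x S by simp
  then have "x \<in> S \<and> f x = g x"
  proof (induction rule: span_induct_alt)
    case base
    show ?case
      using linear_onD(2)[OF f, of 0 0] linear_onD(2)[OF g, of 0 0] subspace_0[OF S(1)] by simp
  next
    case (step c x y)
    then have "x \<in> S" using S span_base by blast
    then show ?case
      using step eq linear_onD[OF f] linear_onD[OF g] S(1) subspace_add subspace_scale by metis
  qed
  then show ?thesis by simp
qed

locale sym_form =
  fixes U :: "'u::real_vector set" and b :: "'u \<Rightarrow> 'u \<Rightarrow> real"
  assumes subspace_U: "subspace U"
    and b_add_left: "\<lbrakk>x \<in> U; y \<in> U; z \<in> U\<rbrakk> \<Longrightarrow> b (x + y) z = b x z + b y z"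
    and b_scale_left: "\<lbrakk>x \<in> U; z \<in> U\<rbrakk> \<Longrightarrow> b (c *\<^sub>R x) z = c * b x z"
    and b_sym: "\<lbrakk>x \<in> U; y \<in> U\<rbrakk> \<Longrightarrow> b x y = b y x"
begin

lemma U_closed [simp]:
  "0 \<in> U" "x \<in> U \<Longrightarrow> y \<in> U \<Longrightarrow> x + y \<in> U" "x \<in> U \<Longrightarrow> y \<in> U \<Longrightarrow> x - y \<in> U"
  "x \<in> U \<Longrightarrow> - x \<in> U" "x \<in> U \<Longrightarrow> c *\<^sub>R x \<in> U"
  using subspace_U by (auto simp: subspace_0 subspace_add subspace_diff subspace_neg subspace_scale)

lemma b_add_right: "\<lbrakk>x \<in> U; y \<in> U; z \<in> U\<rbrakk> \<Longrightarrow> b z (x + y) = b z x + b z y"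
  by (simp add: b_sym[of z] b_add_left)

lemma b_scale_right: "\<lbrakk>x \<in> U; z \<in> U\<rbrakk> \<Longrightarrow> b z (c *\<^sub>R x) = c * b z x"
  by (simp add: b_sym[of z] b_scale_left)

lemma b_minus_left: "\<lbrakk>x \<in> U; z \<in> U\<rbrakk> \<Longrightarrow> b (- x) z = - b x z"
  using b_scale_left[of x z "-1"] by simp

lemma b_minus_right: "\<lbrakk>x \<in> U; z \<in> U\<rbrakk> \<Longrightarrow> b z (- x) = - b z x"
  using b_scale_right[of x z "-1"] by simp

lemma b_zero_left: "z \<in> U \<Longrightarrow> b 0 z = 0"
  using b_scale_left[of 0 z 0] by simp

lemma b_zero_right: "z \<in> U \<Longrightarrow> b z 0 = 0"
  using b_scale_right[of 0 z 0] by simp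

lemma b_diff_left: "\<lbrakk>x \<in> U; y \<in> U; z \<in> U\<rbrakk> \<Longrightarrow> b (x - y) z = b x z - b y z"
  using b_add_left[of x "- y" z] by (simp add: b_minus_left)

lemma b_sum_left:
  "\<lbrakk>finite K; \<And>k. k \<in> K \<Longrightarrow> f k \<in> U; z \<in> U\<rbrakk> \<Longrightarrow> b (\<Sum>k\<in>K. f k) z = (\<Sum>k\<in>K. b (f k) z)"
  by (induction K rule: finite_induct) (auto simp: b_zero_left b_add_left subspace_sum[OF subspace_U])

lemmas b_simps = b_add_left b_add_right b_scale_left b_scale_right b_minus_left b_minus_right
  b_zero_left b_zero_right b_diff_left

lemma form_eq_on_span:
  assumes "\<And>x y. x \<in> S \<Longrightarrow> y \<in> S' \<Longrightarrow> b x y = 0" "S \<subseteq> U" "S' \<subseteq> U"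
    and "x \<in> span S" "y \<in> span S'"
  shows "b x y = 0"
proof -
  have sub: "span S \<subseteq> U" "span S' \<subseteq> U"
    using assms(2,3) subspace_U by (simp_all add: span_minimal)
  have "span S' \<subseteq> {y \<in> U. \<forall>u\<in>S. b u y = 0}"
    by (rule span_minimal) (use assms(1-3) in \<open>auto simp: subspace_def b_simps subset_iff\<close>)
  then have "span S \<subseteq> {x \<in> U. b x y = 0}"
    using assms(2,5) sub by (intro span_minimal) (auto simp: subspace_def b_simps subset_iff)
  then show ?thesis using assms(4) by blast
qed

lemma nondegenerate_eqI:
  assumes "nondegenerate_on U b" "x \<in> U" "x' \<in> U" "\<And>y. y \<in> U \<Longrightarrow> b x y = b x' y"
  shows "x = x'"
proof -
  have "b (x - x') y = 0" if "y \<in> U" for y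
    using that assms by (simp add: b_diff_left)
  then have "x - x' = 0"
    using assms(1-3) unfolding nondegenerate_on_def by (meson U_closed(3))
  then show ?thesis by simp
qed

text \<open>The Gram matrix between \<open>f\<close> and \<open>g\<close> is diagonal with nonzero
  entries, so pairing a combination of the \<open>f k\<close> with \<open>g l\<close> isolates the
  coefficient of \<open>f l\<close>.\<close>

lemma nondegenerate_on_spanI:
  fixes f g :: "'k \<Rightarrow> 'u"
  assumes K: "finite K" and X: "X = span (f ` K)" and f: "f ` K \<subseteq> U" and g: "g ` K \<subseteq> X"
    and diag: "\<And>k. k \<in> K \<Longrightarrow> b (f k) (g k) \<noteq> 0"
    and off: "\<And>k l. k \<in> K \<Longrightarrow> l \<in> K \<Longrightarrow> k \<noteq> l \<Longrightarrow> b (f k) (g l) = 0"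
  shows "nondegenerate_on X b"
  unfolding nondegenerate_on_def
proof (intro ballI impI)
  fix x assume x: "x \<in> X" "\<forall>y\<in>X. b x y = 0"
  have "X \<subseteq> U" unfolding X using f subspace_U by (simp add: span_minimal)
  from x(1)[unfolded X] have "\<exists>c. x = (\<Sum>k\<in>K. c k *\<^sub>R f k)"
  proof (induction rule: span_induct_alt)
    case base
    show ?case by (rule exI[of _ "\<lambda>_. 0"]) simp
  next
    case (step a z y)
    then obtain c k where c: "y = (\<Sum>k\<in>K. c k *\<^sub>R f k)" and k: "k \<in> K" "z = f k" by auto
    have "(\<Sum>l\<in>K. (c l + (if l = k then a else 0)) *\<^sub>R f l) =
        (\<Sum>l\<in>K. c l *\<^sub>R f l + (if k = l then a *\<^sub>R f l else 0))"
      by (intro sum.cong) (auto simp: scaleR_add_left)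
    also have "\<dots> = y + a *\<^sub>R z"
      using K k c by (simp add: sum.distrib)
    finally show ?case by (intro exI[of _ "\<lambda>l. c l + (if l = k then a else 0)"]) simp
  qed
  then obtain c where c: "x = (\<Sum>k\<in>K. c k *\<^sub>R f k)" by blast
  have "c l = 0" if l: "l \<in> K" for l
  proof -
    have gl: "g l \<in> U" using l g \<open>X \<subseteq> U\<close> by auto
    have "0 = b x (g l)" using x(2) l g by auto
    also have "\<dots> = (\<Sum>k\<in>K. b (c k *\<^sub>R f k) (g l))"
      unfolding c by (rule b_sum_left) (use K f gl in auto)
    also have "\<dots> = (\<Sum>k\<in>K. if k = l then c l * b (f l) (g l) else 0)"
      by (intro sum.cong) (use f gl l off in \<open>auto simp: b_scale_left image_subset_iff\<close>)
    also have "\<dots> = c l * b (f l) (g l)" using K l by simp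
    finally show ?thesis using diag[OF l] by simp
  qed
  then show "x = 0" using c by simp
qed

end

text \<open>The span of the pairs \<open>(f i, g i)\<close> is the graph of the isometry: by equality of the Gram
  matrices it is totally isotropic for the difference of the two forms, and these are
  non-degenerate.\<close>

lemma isometry_extension:
  fixes f :: "'i \<Rightarrow> 'u::real_vector" and g :: "'i \<Rightarrow> 'v::real_vector"
  assumes "sym_form U b" "sym_form W c" and nd: "nondegenerate_on U b" "nondegenerate_on W c"
    and U: "U = span (f ` I)" and W: "W = span (g ` I)"
    and gram: "\<And>i j. i \<in> I \<Longrightarrow> j \<in> I \<Longrightarrow> c (g i) (g j) = b (f i) (f j)"
  obtains A where "linear_on U A" "bij_betw A U W" "\<And>i. i \<in> I \<Longrightarrow> A (f i) = g i"
    "\<And>x y. x \<in> U \<Longrightarrow> y \<in> U \<Longrightarrow> c (A x) (A y) = b x y"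
proof -
  interpret U: sym_form U b by fact
  interpret W: sym_form W c by fact
  define \<Gamma> where "\<Gamma> = span ((\<lambda>i. (f i, g i)) ` I)"
  have fst\<Gamma>: "fst ` \<Gamma> = U"
    unfolding \<Gamma>_def U by (simp add: linear_span_image[OF linear_fst, symmetric] image_image)
  have snd\<Gamma>: "snd ` \<Gamma> = W"
    unfolding \<Gamma>_def W by (simp add: linear_span_image[OF linear_snd, symmetric] image_image)
  have mem: "x \<in> U" "y \<in> W" if "(x, y) \<in> \<Gamma>" for x y
    using that fst\<Gamma> snd\<Gamma> by force+
  interpret P: sym_form "U \<times> W" "\<lambda>p q. b (fst p) (fst q) - c (snd p) (snd q)"
  proof
    show "b (fst x) (fst y) - c (snd x) (snd y) = b (fst y) (fst x) - c (snd y) (snd x)"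
      if "x \<in> U \<times> W" "y \<in> U \<times> W" for x y
      using that U.b_sym W.b_sym by (metis mem_Times_iff)
  qed (auto simp: U.b_simps W.b_simps subspace_Times U.subspace_U W.subspace_U algebra_simps)
  have iso: "c y y' = b x x'" if "(x, y) \<in> \<Gamma>" "(x', y') \<in> \<Gamma>" for x y x' y'
  proof -
    have sub: "(\<lambda>i. (f i, g i)) ` I \<subseteq> U \<times> W"
      unfolding U W by (auto intro: span_base)
    have "b (fst (x, y)) (fst (x', y')) - c (snd (x, y)) (snd (x', y')) = 0"
      by (rule P.form_eq_on_span[OF _ sub sub]) (use that gram in \<open>auto simp: \<Gamma>_def\<close>)
    then show ?thesis by simp
  qed
  have fun1: "y = y'" if "(x, y) \<in> \<Gamma>" "(x, y') \<in> \<Gamma>" for x y y'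
  proof (rule W.nondegenerate_eqI[OF nd(2)])
    fix w assume "w \<in> W"
    then obtain u where "(u, w) \<in> \<Gamma>" using snd\<Gamma> by force
    then show "c y w = c y' w" using iso that by metis
  qed (use that mem in auto)
  have fun2: "x = x'" if "(x, y) \<in> \<Gamma>" "(x', y) \<in> \<Gamma>" for x x' y
  proof (rule U.nondegenerate_eqI[OF nd(1)])
    fix u assume "u \<in> U"
    then obtain w where "(u, w) \<in> \<Gamma>" using fst\<Gamma> by force
    then show "b x u = b x' u" using iso that by metis
  qed (use that mem in auto)
  define A where "A = (\<lambda>x. THE y. (x, y) \<in> \<Gamma>)"
  have A: "A x = y" if "(x, y) \<in> \<Gamma>" for x y
    unfolding A_def using that fun1 by blast
  have A': "(x, A x) \<in> \<Gamma>" if "x \<in> U" for x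
    using that A fst\<Gamma> by force
  have sub\<Gamma>: "subspace \<Gamma>" unfolding \<Gamma>_def by (rule subspace_span)
  show ?thesis
  proof
    show "linear_on U A"
      unfolding linear_on_def
    proof (intro conjI ballI allI)
      show "A (x + y) = A x + A y" if "x \<in> U" "y \<in> U" for x y
        using subspace_add[OF sub\<Gamma> A'[OF that(1)] A'[OF that(2)]] by (auto intro: A)
      show "A (a *\<^sub>R x) = a *\<^sub>R A x" if "x \<in> U" for a x
        using subspace_scale[OF sub\<Gamma> A'[OF that]] by (auto intro: A)
    qed
    show "bij_betw A U W"
      unfolding bij_betw_def
    proof
      show "inj_on A U" by (rule inj_onI) (metis A' fun2)
      show "A ` U = W" using A' A mem snd\<Gamma> by (force simp: image_iff)
    qed
    show "A (f i) = g i" if "i \<in> I" for i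
      using that by (intro A) (auto simp: \<Gamma>_def intro: span_base)
    show "c (A x) (A y) = b x y" if "x \<in> U" "y \<in> U" for x y
      using iso A' that by blast
  qed
qed

section \<open>Clifford families\<close>

text \<open>Only the images of an orthonormal basis are kept, with \<epsilon> i the scalar square of
  the i-th basis vector. Individual signs can then be flipped in any position, whereas
  \<open>sp r s\<close> fixes the order of the signs.\<close>

locale clifford_family = sym_form U b
  for n :: nat and U :: "'u::real_vector set" and E :: "nat \<Rightarrow> 'u \<Rightarrow> 'u" and \<epsilon> :: "nat \<Rightarrow> real"
    and b :: "'u \<Rightarrow> 'u \<Rightarrow> real" +
  assumes E_closed: "i < n \<Longrightarrow> x \<in> U \<Longrightarrow> E i x \<in> U"
    and E_add: "\<lbrakk>i < n; x \<in> U; y \<in> U\<rbrakk> \<Longrightarrow> E i (x + y) = E i x + E i y"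
    and E_scale: "\<lbrakk>i < n; x \<in> U\<rbrakk> \<Longrightarrow> E i (c *\<^sub>R x) = c *\<^sub>R E i x"
    and eps: "i < n \<Longrightarrow> \<epsilon> i * \<epsilon> i = 1"
    and E_sq: "\<lbrakk>i < n; x \<in> U\<rbrakk> \<Longrightarrow> E i (E i x) = - (\<epsilon> i *\<^sub>R x)"
    and anticomm: "\<lbrakk>i < n; j < n; i \<noteq> j; x \<in> U\<rbrakk> \<Longrightarrow> E i (E j x) = - E j (E i x)"
    and skew: "\<lbrakk>i < n; x \<in> U; y \<in> U\<rbrakk> \<Longrightarrow> b (E i x) y = - b x (E i y)"
begin

lemma E_minus: "\<lbrakk>i < n; x \<in> U\<rbrakk> \<Longrightarrow> E i (- x) = - E i x"
  using E_scale[of i x "-1"] by simp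

lemma E_zero: "i < n \<Longrightarrow> E i 0 = 0"
  using E_scale[of i 0 0] by simp

lemma word_closed: "set w \<subseteq> {..<n} \<Longrightarrow> x \<in> U \<Longrightarrow> foldr E w x \<in> U"
  by (induction w) (auto simp: E_closed)

lemma word_add: "\<lbrakk>set w \<subseteq> {..<n}; x \<in> U; y \<in> U\<rbrakk> \<Longrightarrow> foldr E w (x + y) = foldr E w x + foldr E w y"
  by (induction w) (auto simp: E_add word_closed)

lemma word_scale: "\<lbrakk>set w \<subseteq> {..<n}; x \<in> U\<rbrakk> \<Longrightarrow> foldr E w (c *\<^sub>R x) = c *\<^sub>R foldr E w x"
  by (induction w) (auto simp: E_scale word_closed)

lemma word_minus: "\<lbrakk>set w \<subseteq> {..<n}; x \<in> U\<rbrakk> \<Longrightarrow> foldr E w (- x) = - foldr E w x"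
  using word_scale[of w x "-1"] by simp

lemmas E_simps = E_closed E_add E_scale E_minus word_closed word_add word_scale word_minus

lemma E_word_notin:
  assumes "i < n" "set w \<subseteq> {..<n}" "i \<notin> set w" "x \<in> U"
  shows "E i (foldr E w x) = (-1) ^ length w *\<^sub>R foldr E w (E i x)"
  using assms(2,3)
proof (induction w)
  case (Cons j w)
  have "E i (foldr E (j # w) x) = - E j (E i (foldr E w x))"
    using assms Cons.prems by (auto simp: E_simps intro!: anticomm)
  also have "E i (foldr E w x) = (-1) ^ length w *\<^sub>R foldr E w (E i x)"
    using Cons by simp
  finally show ?case using Cons.prems assms by (simp add: E_simps)
qed simp

text \<open>Passing the equal letter costs no sign, so there is one sign change fewer than there are
  letters.\<close>

lemma E_word_in:
  assumes "i < n" "set w \<subseteq> {..<n}" "i \<in> set w" "distinct w" "x \<in> U"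
  shows "E i (foldr E w x) = - ((-1) ^ length w *\<^sub>R foldr E w (E i x))"
  using assms(2-4)
proof (induction w)
  case (Cons j w)
  show ?case
  proof (cases "i = j")
    case True
    then have "E i (foldr E w x) = (-1) ^ length w *\<^sub>R foldr E w (E i x)"
      using Cons assms by (intro E_word_notin) auto
    then show ?thesis using True Cons assms by (simp add: E_simps)
  next
    case False
    then have "E i (foldr E (j # w) x) = - E j (E i (foldr E w x))"
      using assms Cons.prems by (auto simp: E_simps intro!: anticomm)
    then show ?thesis using False Cons assms by (simp add: E_simps)
  qed
qed simp

lemma E_word_pm:
  assumes "i < n" "set w \<subseteq> {..<n}" "distinct w"
  obtains s where "s = 1 \<or> s = (-1::real)"
    "\<And>x. x \<in> U \<Longrightarrow> E i (foldr E w x) = s *\<^sub>R foldr E w (E i x)"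
proof (cases "i \<in> set w")
  case True
  show thesis
    by (rule that[of "- ((-1) ^ length w)"])
      (use True assms E_word_in in \<open>auto simp: minus_one_power_iff\<close>)
next
  case False
  show thesis
    by (rule that[of "(-1) ^ length w"])
      (use False assms E_word_notin in \<open>auto simp: minus_one_power_iff\<close>)
qed

text \<open>Bringing equal letters of the two copies together takes \<open>length w choose 2\<close>
  transpositions, and each merged pair contributes \<open>- e\<close>.\<close>

lemma word_sq:
  assumes "distinct w" "set w \<subseteq> {..<n}" "\<And>i. i \<in> set w \<Longrightarrow> \<epsilon> i = e" "x \<in> U"
  shows "foldr E w (foldr E w x) = ((-1) ^ (length w choose 2) * (- e) ^ length w) *\<^sub>R x"
  using assms(1-3)
proof (induction w)
  case Nil
  then show ?case by (simp add: binomial_eq_0)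
next
  case (Cons i w)
  then have i: "i < n" "set w \<subseteq> {..<n}" "i \<notin> set w" "\<epsilon> i = e" by auto
  have "foldr E w (E i (foldr E w x)) = (-1) ^ length w *\<^sub>R E i (foldr E w (foldr E w x))"
    using E_word_notin[OF i(1-3), of "foldr E w x"] i assms by (simp add: E_simps)
  then have "foldr E (i # w) (foldr E (i # w) x) =
      (-1) ^ length w *\<^sub>R E i (E i (foldr E w (foldr E w x)))"
    using i assms by (simp add: E_simps)
  also have "\<dots> = ((-1) ^ length w * - e) *\<^sub>R foldr E w (foldr E w x)"
    using i assms by (simp add: E_simps E_sq)
  also have "\<dots> = ((-1) ^ (length (i # w) choose 2) * (- e) ^ length (i # w)) *\<^sub>R x"
    using Cons by (simp add: numeral_2_eq_2 power_add mult_ac)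
  finally show ?case .
qed

lemma word_isometry:
  assumes "set w \<subseteq> {..<n}" "x \<in> U" "y \<in> U"
  shows "b (foldr E w x) (foldr E w y) = (\<Prod>i\<leftarrow>w. \<epsilon> i) * b x y"
  using assms(1)
proof (induction w)
  case (Cons i w)
  have "b (E i u) (E i v) = \<epsilon> i * b u v" if "u \<in> U" "v \<in> U" for u v
    using that Cons.prems by (simp add: skew E_simps E_sq b_simps)
  then show ?case using Cons assms by (simp add: E_simps)
qed simp

text \<open>The sign is left unspecified: later arguments only ask whether a pairing vanishes or
  which vectors span.\<close>

lemma word_perm:
  assumes "distinct w" "distinct w'" "set w = set w'" "set w \<subseteq> {..<n}"
  obtains s where "s = 1 \<or> s = (-1::real)" "\<And>x. x \<in> U \<Longrightarrow> foldr E w x = s *\<^sub>R foldr E w' x"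
proof -
  have "\<exists>s. (s = 1 \<or> s = (-1::real)) \<and> (\<forall>x\<in>U. foldr E w x = s *\<^sub>R foldr E w' x)"
    using assms
  proof (induction w arbitrary: w')
    case Nil
    then show ?case by (intro exI[of _ 1]) auto
  next
    case (Cons i w)
    then have "i \<in> set w'" by auto
    then obtain u v where w': "w' = u @ i # v" by (meson split_list)
    have sub: "i < n" "set w \<subseteq> {..<n}" "set u \<subseteq> {..<n}" "set v \<subseteq> {..<n}" "i \<notin> set u"
      using Cons.prems w' by auto
    have "distinct w" "distinct (u @ v)" "set w = set (u @ v)" "set w \<subseteq> {..<n}"
      using Cons.prems w' by auto
    from Cons.IH[OF this] obtain s where s: "s = 1 \<or> s = (-1::real)"
      "\<And>x. x \<in> U \<Longrightarrow> foldr E w x = s *\<^sub>R foldr E (u @ v) x" by blast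
    have "foldr E (i # w) x = (s * (-1) ^ length u) *\<^sub>R foldr E w' x" if x: "x \<in> U" for x
      using s(2)[OF x] E_word_notin[of i u "foldr E v x"] sub x w' by (simp add: E_simps)
    moreover have "s * (-1) ^ length u = 1 \<or> s * (-1) ^ length u = -1"
      using s(1) by (auto simp: minus_one_power_iff)
    ultimately show ?case by blast
  qed
  then show thesis using that by blast
qed

text \<open>The span of this set is the submodule generated by \<open>S\<close>; the empty word
  accounts for \<open>S\<close> itself.\<close>

definition gen_words :: "'u set \<Rightarrow> 'u set" where
  "gen_words S = (\<lambda>(w, v). foldr E w v) ` (lists {..<n} \<times> S)"

lemma gen_words_subset: "S \<subseteq> U \<Longrightarrow> gen_words S \<subseteq> U"
  by (auto simp: gen_words_def E_simps lists_eq_set subset_iff)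

lemma E_span:
  assumes "i < n" "X \<subseteq> U" "E i ` X \<subseteq> span X" "x \<in> span X"
  shows "E i x \<in> span X"
proof -
  have "span X \<subseteq> {x \<in> U. E i x \<in> span X}"
    by (rule span_minimal)
      (use assms(1-3) in \<open>auto simp: subspace_def E_simps E_zero span_add span_scale span_zero\<close>)
  then show ?thesis using assms(4) by blast
qed

lemma E_gen_words: "i < n \<Longrightarrow> E i ` gen_words S \<subseteq> gen_words S"
  unfolding gen_words_def by (auto intro!: image_eqI[where x = "(i # _, _)"])

lemma word_invariant:
  assumes "\<And>i. i < n \<Longrightarrow> E i ` X \<subseteq> X" "set w \<subseteq> {..<n}" "x \<in> X"
  shows "foldr E w x \<in> X"
  using assms(2) by (induction w) (use assms in auto)

text \<open>Minimality of an admissible module is used only through its submodules.\<close>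

definition simple :: bool where
  "simple \<longleftrightarrow> U \<noteq> {0} \<and> nondegenerate_on U b \<and>
     (\<forall>X. subspace X \<and> X \<subseteq> U \<and> X \<noteq> {0} \<and> (\<forall>i<n. E i ` X \<subseteq> X) \<and> nondegenerate_on X b \<longrightarrow> X = U)"

end

text \<open>The \<open>4 k\<close> factors form \<open>2 k\<close> pairs, whose signs cancel. It
  serves twice: for generators multiplied by the twisting product, and for generators multiplied by
  the grading involution.\<close>

lemma foldr_negated_pairs:
  assumes "\<And>i x. i \<in> set w \<Longrightarrow> x \<in> U \<Longrightarrow> G i x \<in> U"
    and "\<And>i x. i \<in> set w \<Longrightarrow> x \<in> U \<Longrightarrow> H i x \<in> U \<and> H i (- x) = - H i x"
    and "\<And>i j x. i \<in> set w \<Longrightarrow> j \<in> set w \<Longrightarrow> i \<noteq> j \<Longrightarrow> x \<in> U \<Longrightarrow> G i (G j x) = - H i (H j x)"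
    and "distinct w" "length w = 4 * k" "x \<in> (U::'u::real_vector set)"
  shows "foldr G w x = foldr H w x"
  using assms(1-5)
proof (induction k arbitrary: w)
  case (Suc k)
  then have "length w = Suc (Suc (Suc (Suc (4 * k))))" by simp
  then obtain p q r s v where w: "w = p # q # r # s # v" and v: "length v = 4 * k"
    by (auto simp: length_Suc_conv)
  have IH: "foldr G v x = foldr H v x"
    using Suc.prems w v by (intro Suc.IH) auto
  have z: "foldr G v x \<in> U"
    using Suc.prems(1) \<open>x \<in> U\<close> unfolding w by (induction v) auto
  have GH: "G r (G s (foldr G v x)) = - H r (H s (foldr G v x))"
    using Suc.prems(3,4) w z by simp
  have G: "G r (G s (foldr G v x)) \<in> U"
    using Suc.prems(1) w z by simp
  have H: "H r (H s (foldr G v x)) \<in> U" "H q (H r (H s (foldr G v x))) \<in> U"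
    using Suc.prems(2) w z by simp_all
  have "G p (G q (G r (G s (foldr G v x)))) = - H p (H q (G r (G s (foldr G v x))))"
    using Suc.prems(3,4) w G by simp
  also have "\<dots> = H p (H q (H r (H s (foldr G v x))))"
    using Suc.prems(2) w H by (simp add: GH)
  finally have "G p (G q (G r (G s (foldr G v x)))) = H p (H q (H r (H s (foldr G v x))))" .
  then show ?case using w IH by simp
qed simp

section \<open>Families of neutral signature\<close>

text \<open>The generator \<open>i < m\<close>, of square \<open>-1\<close>, is paired with the generator \<open>2 m - 1 - i\<close>, of
  square \<open>1\<close>.  The vectors of \<open>vac\<close> are the vacua of the corresponding Fock representation, that
  is, the common fixed vectors of the commuting involutions \<open>P i\<close>.\<close>

locale split_family = clifford_family "2 * m" U E "\<lambda>i. if i < m then 1 else - 1" b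
  for m :: nat and U :: "'u::real_vector set" and E b
begin

definition vac :: "'u set" where
  "vac = {u \<in> U. \<forall>i<m. E (2 * m - Suc i) u = - E i u}"

definition P :: "nat \<Rightarrow> 'u \<Rightarrow> 'u" where
  "P i x = E i (E (2 * m - Suc i) x)"

definition \<beta> :: "'u \<Rightarrow> 'u \<Rightarrow> real" where
  "\<beta> u u' = b u (foldr E [0..<m] u')"

lemma vac_U [simp]: "u \<in> vac \<Longrightarrow> u \<in> U"
  by (simp add: vac_def)

lemma vac_mirror:
  assumes u: "u \<in> vac" and i: "i < 2 * m"
  shows "E (2 * m - Suc i) u = - E i u"
proof -
  have lower: "E (2 * m - Suc j) u = - E j u" if "j < m" for j
    using u that unfolding vac_def by blast
  show ?thesis
  proof (cases "i < m")
    case False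
    have "2 * m - Suc i < m" "2 * m - Suc (2 * m - Suc i) = i" using False i by auto
    with lower[of "2 * m - Suc i"] show ?thesis by simp
  qed (rule lower)
qed

lemma vac_scale:
  assumes u: "u \<in> vac"
  shows "c *\<^sub>R u \<in> vac"
proof -
  have "E (2 * m - Suc i) (c *\<^sub>R u) = - E i (c *\<^sub>R u)" if "i < m" for i
    using vac_mirror[OF u, of i] that u by (simp add: E_scale)
  moreover have "c *\<^sub>R u \<in> U" using u by simp
  ultimately show ?thesis unfolding vac_def by blast
qed

lemma vac_add:
  assumes u: "u \<in> vac" "u' \<in> vac"
  shows "u + u' \<in> vac"
proof -
  have "E (2 * m - Suc i) (u + u') = - E i (u + u')" if "i < m" for i
    using vac_mirror[OF u(1), of i] vac_mirror[OF u(2), of i] that u by (simp add: E_add)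
  moreover have "u + u' \<in> U" using u by simp
  ultimately show ?thesis unfolding vac_def by blast
qed

section \<open>Words applied to vacua and their pairings\<close>

lemma full_subset: "set [0..<m] \<subseteq> {..<2 * m}"
  by auto

text \<open>On a vacuum a generator with index at least \<open>m\<close> acts as minus its mirror
  image below \<open>m\<close>, and repeated letters below \<open>m\<close> cancel because their
  squares are -1. Up to sign, the vectors obtained are therefore indexed by the subsets of
  \<open>{..<m}\<close>, as in a Fock space.\<close>

lemma normal_form:
  assumes "set w \<subseteq> {..<2 * m}"
  obtains xs s where "distinct xs" "set xs \<subseteq> {..<m}" "s = 1 \<or> s = (-1::real)"
    "\<And>u. u \<in> vac \<Longrightarrow> foldr E w u = s *\<^sub>R foldr E xs u"
proof -
  \<comment> \<open>Multiplication by a generator below \<open>m\<close> toggles the membership of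
    its index.\<close>
  have lower: "\<exists>ys t. distinct ys \<and> set ys \<subseteq> {..<m} \<and> (t = 1 \<or> t = (-1::real)) \<and>
      (\<forall>x\<in>U. E i (foldr E xs x) = t *\<^sub>R foldr E ys x)"
    if i: "i < m" and xs: "distinct xs" "set xs \<subseteq> {..<m}" for i xs
  proof (cases "i \<in> set xs")
    case False
    have "\<forall>x\<in>U. E i (foldr E xs x) = 1 *\<^sub>R foldr E (i # xs) x" by simp
    moreover have "distinct (i # xs)" "set (i # xs) \<subseteq> {..<m}" using False that by auto
    ultimately show ?thesis by blast
  next
    case True
    have *: "set xs = set (i # remove1 i xs)" "distinct (i # remove1 i xs)"
      using True xs by auto
    have sub: "set (remove1 i xs) \<subseteq> {..<2 * m}" "set xs \<subseteq> {..<2 * m}"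
      using xs set_remove1_subset[of i xs] by auto
    obtain s where s: "s = 1 \<or> s = (-1::real)"
      "\<And>x. x \<in> U \<Longrightarrow> foldr E xs x = s *\<^sub>R foldr E (i # remove1 i xs) x"
      using word_perm[OF xs(1) *(2,1) sub(2)] by blast
    have "E i (foldr E xs x) = (- s) *\<^sub>R foldr E (remove1 i xs) x" if "x \<in> U" for x
      using that i s(2)[OF that] sub by (simp add: E_simps E_sq)
    moreover have "distinct (remove1 i xs)" "set (remove1 i xs) \<subseteq> {..<m}" "- s = 1 \<or> - s = -1"
      using s(1) xs set_remove1_subset[of i xs] by auto
    ultimately show ?thesis by blast
  qed
  have "\<exists>xs s. distinct xs \<and> set xs \<subseteq> {..<m} \<and> (s = 1 \<or> s = (-1::real)) \<and>
      (\<forall>u\<in>vac. foldr E w u = s *\<^sub>R foldr E xs u)"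
    using assms
  proof (induction w)
    case Nil
    then show ?case by (intro exI[of _ "[]"] exI[of _ 1]) auto
  next
    case (Cons i w)
    then have i: "i < 2 * m" by auto
    have "set w \<subseteq> {..<2 * m}" using Cons.prems by auto
    from Cons.IH[OF this] obtain xs s
      where xs: "distinct xs" "set xs \<subseteq> {..<m}" and s: "s = 1 \<or> s = (-1::real)"
        and w: "\<And>u. u \<in> vac \<Longrightarrow> foldr E w u = s *\<^sub>R foldr E xs u" by blast
    have sub: "set xs \<subseteq> {..<2 * m}" using xs by force
    \<comment> \<open>\<open>j\<close> is the index below \<open>m\<close> whose generator agrees
      with that of \<open>i\<close> on vacua up to sign. The letter \<open>i\<close> is moved
      through \<open>xs\<close> to the vacuum, exchanged for \<open>j\<close> there, and moved
      back.\<close>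
    define j where "j = (if i < m then i else 2 * m - Suc i)"
    have j: "j < m" "j < 2 * m" using i by (auto simp: j_def)
    have "\<exists>r. (r = 1 \<or> r = (-1::real)) \<and> (\<forall>u\<in>vac. E i (foldr E xs u) = r *\<^sub>R E j (foldr E xs u))"
    proof (cases "i < m")
      case True
      then show ?thesis by (intro exI[of _ 1]) (simp add: j_def)
    next
      case False
      obtain p where p: "p = 1 \<or> p = (-1::real)"
        "\<And>x. x \<in> U \<Longrightarrow> E i (foldr E xs x) = p *\<^sub>R foldr E xs (E i x)"
        using E_word_pm[OF i sub xs(1)] by blast
      obtain q where q: "q = 1 \<or> q = (-1::real)"
        "\<And>x. x \<in> U \<Longrightarrow> E j (foldr E xs x) = q *\<^sub>R foldr E xs (E j x)"
        using E_word_pm[OF j(2) sub xs(1)] by blast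
      have "E i (foldr E xs u) = (- p * q) *\<^sub>R E j (foldr E xs u)" if u: "u \<in> vac" for u
      proof -
        have "E j u = - E i u" using vac_mirror[OF u i] False by (simp add: j_def)
        then show ?thesis
          using p(2)[of u] q(2)[of u] q(1) u i j sub by (auto simp: E_simps)
      qed
      then show ?thesis using p(1) q(1) by (intro exI[of _ "- p * q"]) auto
    qed
    then obtain r where r: "r = 1 \<or> r = (-1::real)"
      "\<And>u. u \<in> vac \<Longrightarrow> E i (foldr E xs u) = r *\<^sub>R E j (foldr E xs u)" by blast
    obtain ys t where ys: "distinct ys" "set ys \<subseteq> {..<m}" "t = 1 \<or> t = (-1::real)"
      "\<And>x. x \<in> U \<Longrightarrow> E j (foldr E xs x) = t *\<^sub>R foldr E ys x"
      using lower[OF j(1) xs] by blast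
    have "foldr E (i # w) u = (s * r * t) *\<^sub>R foldr E ys u" if "u \<in> vac" for u
      using that w[OF that] r(2)[OF that] ys(4)[of u] i sub by (simp add: E_simps)
    moreover have "s * r * t = 1 \<or> s * r * t = -1"
      using s r(1) ys(3) by auto
    ultimately show ?case using ys(1,2) by blast
  qed
  then show thesis using that by blast
qed

lemma P_closed: "i < m \<Longrightarrow> x \<in> U \<Longrightarrow> P i x \<in> U"
  by (simp add: P_def E_simps)

text \<open>Both factors of \<open>P i\<close> are skew and they anticommute. Consequently each
  eigenspace of the involution \<open>P i\<close> is totally isotropic, and the form pairs the two
  eigenspaces with each other.\<close>

lemma P_anti_selfadjoint: "\<lbrakk>i < m; x \<in> U; y \<in> U\<rbrakk> \<Longrightarrow> b (P i x) y = - b x (P i y)"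
  by (simp add: P_def E_simps skew anticomm[of "2 * m - Suc i" i] b_simps)

lemma P_word:
  assumes "i < m" "distinct xs" "set xs \<subseteq> {..<m}" "x \<in> U"
  shows "P i (foldr E xs x) = (if i \<in> set xs then -1 else 1) *\<^sub>R foldr E xs (P i x)"
proof -
  have sub: "set xs \<subseteq> {..<2 * m}" "2 * m - Suc i \<notin> set xs" using assms by auto
  have "P i (foldr E xs x) = (-1) ^ length xs *\<^sub>R E i (foldr E xs (E (2 * m - Suc i) x))"
    unfolding P_def using assms sub by (subst E_word_notin) (auto simp: E_simps)
  also have "\<dots> = (if i \<in> set xs then -1 else 1) *\<^sub>R foldr E xs (P i x)"
    using E_word_notin[of i xs "E (2 * m - Suc i) x"] E_word_in[of i xs "E (2 * m - Suc i) x"]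
      assms sub by (auto simp: P_def E_simps)
  finally show ?thesis .
qed

lemma P_vac: "i < m \<Longrightarrow> u \<in> vac \<Longrightarrow> P i u = u"
  unfolding P_def by (simp add: vac_mirror E_simps E_sq)

lemma vacI: "\<lbrakk>u \<in> U; \<And>i. i < m \<Longrightarrow> P i u = u\<rbrakk> \<Longrightarrow> u \<in> vac"
  unfolding vac_def P_def
proof (safe)
  fix i assume u: "u \<in> U" "\<And>i. i < m \<Longrightarrow> E i (E (2 * m - Suc i) u) = u" and i: "i < m"
  have "E i (E i (E (2 * m - Suc i) u)) = - E (2 * m - Suc i) u"
    using u(1) i by (simp add: E_sq E_simps)
  then show "E (2 * m - Suc i) u = - E i u" using u(2)[OF i] by simp
qed

text \<open>Both words are eigenvectors of \<open>P i\<close>, with eigenvalue decided by whether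
  \<open>i\<close> occurs. When the eigenvalues agree, anti-selfadjointness makes the pairing its
  own negative.\<close>

lemma word_orthogonal:
  assumes "u \<in> vac" "u' \<in> vac" "distinct xs" "distinct ys" "set xs \<subseteq> {..<m}" "set ys \<subseteq> {..<m}"
    and i: "i < m" "i \<in> set xs \<longleftrightarrow> i \<in> set ys"
  shows "b (foldr E xs u) (foldr E ys u') = 0"
proof -
  have sub: "set xs \<subseteq> {..<2 * m}" "set ys \<subseteq> {..<2 * m}" using assms by force+
  have "b (P i (foldr E xs u)) (foldr E ys u') = - b (foldr E xs u) (P i (foldr E ys u'))"
    using assms sub by (intro P_anti_selfadjoint) (auto simp: E_simps)
  then show ?thesis
    using assms sub by (simp add: P_word P_vac E_simps b_simps split: if_splits)
qed

text \<open>Generators below \<open>m\<close> are isometries, so \<open>xs\<close> may be applied to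
  both arguments: on the left it squares to a sign, on the right it completes \<open>ys\<close> to
  the full product, up to order.\<close>

lemma word_complementary:
  assumes "distinct xs" "distinct ys" "set xs \<inter> set ys = {}" "set xs \<union> set ys = {..<m}"
  obtains s where "s = 1 \<or> s = (-1::real)"
    "\<And>u u'. u \<in> U \<Longrightarrow> u' \<in> U \<Longrightarrow> b (foldr E xs u) (foldr E ys u') = s * \<beta> u u'"
proof -
  have m: "set xs \<subseteq> {..<m}" "set ys \<subseteq> {..<m}" using assms by auto
  then have sub: "set xs \<subseteq> {..<2 * m}" "set ys \<subseteq> {..<2 * m}" by force+
  obtain s where s: "s = 1 \<or> s = (-1::real)"
    "\<And>x. x \<in> U \<Longrightarrow> foldr E (xs @ ys) x = s *\<^sub>R foldr E [0..<m] x"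
    by (rule word_perm[of "xs @ ys" "[0..<m]"]) (use assms sub in auto)
  define t :: real where "t = (-1) ^ (length xs choose 2) * (-1) ^ length xs"
  have t: "t = 1 \<or> t = -1" by (auto simp: t_def minus_one_power_iff)
  have "map (\<lambda>i. if i < m then 1 else -1) xs = map (\<lambda>i. 1::real) xs"
    using m by (intro map_cong) auto
  then have eps1: "(\<Prod>i\<leftarrow>xs. if i < m then 1 else -1) = (1::real)"
    by (simp add: map_replicate_const)
  have "b (foldr E xs u) (foldr E ys u') = (t * s) * \<beta> u u'" if u: "u \<in> U" "u' \<in> U" for u u'
  proof -
    have "b (foldr E xs u) (foldr E ys u') =
        b (foldr E xs (foldr E xs u)) (foldr E xs (foldr E ys u'))"
      using u sub eps1 by (subst word_isometry) (auto simp: E_simps)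
    also have "foldr E xs (foldr E xs u) = t *\<^sub>R u"
      unfolding t_def using u sub m assms by (intro word_sq) auto
    also have "foldr E xs (foldr E ys u') = s *\<^sub>R foldr E [0..<m] u'"
      using s(2)[OF u(2)] by simp
    finally show ?thesis
      unfolding \<beta>_def using u full_subset by (simp add: b_simps E_simps)
  qed
  moreover have "t * s = 1 \<or> t * s = -1" using s(1) t by auto
  ultimately show thesis using that by blast
qed

text \<open>After reduction to normal form a pairing can be nonzero only for complementary index
  sets, and then it is \<beta> up to sign.\<close>

lemma gen_words_orthogonal:
  assumes "u \<in> vac" "u' \<in> vac" "\<beta> u u' = 0" "set w \<subseteq> {..<2 * m}" "set w' \<subseteq> {..<2 * m}"
  shows "b (foldr E w u) (foldr E w' u') = 0"
proof -
  obtain xs s where xs: "distinct xs" "set xs \<subseteq> {..<m}" "s = 1 \<or> s = (-1::real)"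
    "\<And>u. u \<in> vac \<Longrightarrow> foldr E w u = s *\<^sub>R foldr E xs u"
    using normal_form[OF assms(4)] by blast
  obtain ys t where ys: "distinct ys" "set ys \<subseteq> {..<m}" "t = 1 \<or> t = (-1::real)"
    "\<And>u. u \<in> vac \<Longrightarrow> foldr E w' u = t *\<^sub>R foldr E ys u"
    using normal_form[OF assms(5)] by blast
  have sub: "set xs \<subseteq> {..<2 * m}" "set ys \<subseteq> {..<2 * m}" using xs ys by force+
  have "b (foldr E xs u) (foldr E ys u') = 0"
  proof (cases "\<exists>i<m. i \<in> set xs \<longleftrightarrow> i \<in> set ys")
    case True
    then show ?thesis using word_orthogonal assms xs ys by blast
  next
    case False
    then have "set xs \<inter> set ys = {}" "set xs \<union> set ys = {..<m}" using xs ys by auto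
    from word_complementary[OF xs(1) ys(1) this] show ?thesis
      using assms by (metis vac_U mult_zero_right)
  qed
  then show ?thesis
    using xs(4)[of u] ys(4)[of u'] assms sub by (simp add: b_simps E_simps)
qed

text \<open>The full product is an isometry whose square is the sign with exponent
  \<open>(m choose 2) + m\<close>, which is \<open>Suc m choose 2\<close> by Pascal's rule.\<close>

lemma \<beta>_sym:
  assumes "u \<in> U" "u' \<in> U"
  shows "\<beta> u' u = (-1) ^ (Suc m choose 2) * \<beta> u u'"
proof -
  let ?F = "foldr E [0..<m]"
  have "map (\<lambda>i. if i < m then 1 else -1) [0..<m] = map (\<lambda>i. 1::real) [0..<m]"
    by (intro map_cong) auto
  then have eps1: "(\<Prod>i\<leftarrow>[0..<m]. if i < m then 1 else -1) = (1::real)"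
    by (simp add: map_replicate_const)
  have "?F (?F u) = ((-1) ^ (length [0..<m] choose 2) * (-1) ^ length [0..<m]) *\<^sub>R u"
    by (rule word_sq) (use assms full_subset in auto)
  then have "?F (?F u) = ((-1) ^ (m choose 2) * (-1) ^ m) *\<^sub>R u" by simp
  moreover have "b (?F u') (?F (?F u)) = b u' (?F u)"
    using assms full_subset eps1 by (subst word_isometry) (auto simp: E_simps)
  ultimately have "\<beta> u' u = ((-1) ^ (m choose 2) * (-1) ^ m) * b (?F u') u"
    unfolding \<beta>_def using assms full_subset by (simp add: b_simps E_simps)
  also have "b (?F u') u = \<beta> u u'"
    unfolding \<beta>_def using assms full_subset by (intro b_sym) (auto simp: E_simps)
  finally show ?thesis by (simp add: numeral_2_eq_2 power_add mult_ac)
qed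

lemma \<beta>_linear:
  "\<lbrakk>u \<in> U; u' \<in> U; x \<in> U\<rbrakk> \<Longrightarrow> \<beta> (u + u') x = \<beta> u x + \<beta> u' x"
  "\<lbrakk>u \<in> U; u' \<in> U; x \<in> U\<rbrakk> \<Longrightarrow> \<beta> x (u + u') = \<beta> x u + \<beta> x u'"
  "\<lbrakk>u \<in> U; x \<in> U\<rbrakk> \<Longrightarrow> \<beta> (c *\<^sub>R u) x = c * \<beta> u x"
  "\<lbrakk>u \<in> U; x \<in> U\<rbrakk> \<Longrightarrow> \<beta> x (c *\<^sub>R u) = c * \<beta> x u"
  using full_subset by (simp_all add: \<beta>_def b_simps E_simps)

end

section \<open>Submodules generated by vacua\<close>

lemma (in clifford_family) span_gen_words_subset:
  assumes "subspace X" "S \<subseteq> X" "\<And>i. i < n \<Longrightarrow> E i ` X \<subseteq> X"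
  shows "span (gen_words S) \<subseteq> X"
  using assms word_invariant[of X] by (intro span_minimal) (auto simp: gen_words_def lists_eq_set)

lemma (in clifford_family) gen_words_base: "S \<subseteq> gen_words S"
  unfolding gen_words_def by (auto intro!: image_eqI[where x = "([], _)"])

lemma (in clifford_family) E_span_gen_words:
  "S \<subseteq> U \<Longrightarrow> i < n \<Longrightarrow> E i ` span (gen_words S) \<subseteq> span (gen_words S)"
  using E_span[of i "gen_words S"] gen_words_subset[of S] E_gen_words[of i S] span_superset by blast

lemma even_Suc_choose_two: "even (Suc m choose 2) \<longleftrightarrow> m mod 4 = 0 \<or> m mod 4 = 3"
proof -
  have c: "Suc m choose 2 = Suc m * m div 2" by (simp add: choose_two)
  have "m mod 4 < 4" by simp
  then consider "m mod 4 = 0" | "m mod 4 = 1" | "m mod 4 = 2" | "m mod 4 = 3" by linarith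
  then show ?thesis
  proof cases
    case 1
    then obtain q where "m = 4 * q" by (metis mod_0_imp_dvd dvdE)
    then have "Suc m * m div 2 = 2 * (Suc m * q)" by simp
    then show ?thesis using 1 c by simp
  next
    case 2
    then obtain q where m: "m = 4 * q + 1" by (metis mult_div_mod_eq)
    then have "Suc m * m = 2 * ((2 * q + 1) * (4 * q + 1))" by (simp add: algebra_simps)
    then have "Suc m choose 2 = (2 * q + 1) * (4 * q + 1)" using c by simp
    then show ?thesis using 2 by simp
  next
    case 3
    then obtain q where m: "m = 4 * q + 2" by (metis mult_div_mod_eq)
    then have "Suc m * m = 2 * ((4 * q + 3) * (2 * q + 1))" by (simp add: algebra_simps)
    then have "Suc m choose 2 = (4 * q + 3) * (2 * q + 1)" using c by simp
    then show ?thesis using 3 by simp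
  next
    case 4
    then obtain q where m: "m = 4 * q + 3" by (metis mult_div_mod_eq)
    then have "Suc m * m = 2 * (2 * ((q + 1) * (4 * q + 3)))" by (simp add: algebra_simps)
    then have "Suc m choose 2 = 2 * ((q + 1) * (4 * q + 3))" using c by simp
    then show ?thesis using 4 by simp
  qed
qed

context split_family
begin

text \<open>There is an explicit dual family: the word on an index set at one vacuum is paired with
  the word on the complementary set at the partner vacuum.\<close>

lemma nondegenerate_gen_words:
  fixes v :: "bool \<Rightarrow> 'u"
  assumes v: "\<And>a. v a \<in> vac" and nz: "\<beta> (v True) (v False) \<noteq> 0"
    and iso: "v True = v False \<or> (\<forall>a. \<beta> (v a) (v a) = 0)"
  shows "nondegenerate_on (span (gen_words (range v))) b"
proof -
  \<comment> \<open>For a single vacuum the two Boolean indices give the same vectors, and the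
    matrix would not be diagonal; only one of them is kept.\<close>
  define D where "D = (if v True = v False then {True} else UNIV)"
  define K where "K = Pow {..<m} \<times> D"
  define f where "f = (\<lambda>(S, a). foldr E (sorted_list_of_set S) (v a))"
  define g where "g = (\<lambda>(S, a). foldr E (sorted_list_of_set ({..<m} - S)) (v (\<not> a)))"
  have fin: "finite S" if "S \<subseteq> {..<m}" for S using that finite_subset by blast
  have nz': "\<beta> (v a) (v (\<not> a)) \<noteq> 0" for a
    using nz \<beta>_sym[of "v True" "v False"] v by (cases a) auto
  have sub: "{..<m} \<subseteq> {..<2 * m}" by auto
  have word_in: "foldr E (sorted_list_of_set S) (v a) \<in> gen_words (range v)"
    if "S \<subseteq> {..<m}" for S a
    unfolding gen_words_def
    by (rule image_eqI[where x = "(sorted_list_of_set S, v a)"])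
      (use that fin[OF that] sub in \<open>auto simp: lists_eq_set\<close>)
  have fK: "f ` K \<subseteq> gen_words (range v)"
    unfolding f_def K_def using word_in by auto
  have "foldr E w (v a) \<in> span (f ` K)" if w: "set w \<subseteq> {..<2 * m}" for w a
  proof -
    define a' where "a' = (if v True = v False then True else a)"
    have a': "v a = v a'" "a' \<in> D" by (cases a; auto simp: a'_def D_def)+
    obtain xs s where xs: "distinct xs" "set xs \<subseteq> {..<m}"
      "\<And>u. u \<in> vac \<Longrightarrow> foldr E w u = s *\<^sub>R foldr E xs u"
      using normal_form[OF w] by metis
    obtain t where t: "\<And>x. x \<in> U \<Longrightarrow> foldr E xs x = t *\<^sub>R foldr E (sorted_list_of_set (set xs)) x"
      by (rule word_perm[of xs "sorted_list_of_set (set xs)"]) (use xs sub in auto)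
    have "foldr E w (v a) = (s * t) *\<^sub>R f (set xs, a')"
      using xs(3)[of "v a"] t[of "v a"] v[of a] a' by (simp add: f_def)
    moreover have "f (set xs, a') \<in> f ` K" using xs a' by (auto simp: K_def)
    ultimately show ?thesis by (simp add: span_base span_scale)
  qed
  then have "gen_words (range v) \<subseteq> span (f ` K)"
    by (auto simp: gen_words_def lists_eq_set)
  then have X: "span (gen_words (range v)) = span (f ` K)"
    using fK by (metis span_eq span_superset subset_trans)
  show ?thesis
  proof (rule nondegenerate_on_spanI[of K, OF _ X])
    show "finite K" unfolding K_def D_def by simp
    show "f ` K \<subseteq> U" using fK gen_words_subset[of "range v"] v by fastforce
    show "g ` K \<subseteq> span (gen_words (range v))"
      using word_in unfolding g_def K_def by (auto intro!: span_base)
  next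
    fix k assume "k \<in> K"
    then obtain S a where k: "k = (S, a)" and S: "S \<subseteq> {..<m}" by (auto simp: K_def)
    obtain s where "s = 1 \<or> s = (-1::real)"
      "\<And>u u'. u \<in> U \<Longrightarrow> u' \<in> U \<Longrightarrow> b (foldr E (sorted_list_of_set S) u)
        (foldr E (sorted_list_of_set ({..<m} - S)) u') = s * \<beta> u u'"
      by (rule word_complementary[of "sorted_list_of_set S" "sorted_list_of_set ({..<m} - S)"])
        (use S fin in auto)
    then show "b (f k) (g k) \<noteq> 0"
      using nz'[of a] v unfolding k f_def g_def by auto
  next
    fix k l assume kl: "k \<in> K" "l \<in> K" "k \<noteq> l"
    obtain S a where k: "k = (S, a)" and S: "S \<subseteq> {..<m}" "a \<in> D" using kl by (auto simp: K_def)
    obtain T c where l: "l = (T, c)" and T: "T \<subseteq> {..<m}" "c \<in> D" using kl by (auto simp: K_def)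
    show "b (f k) (g l) = 0"
    proof (cases "S = T")
      case True
      then have ac: "a \<noteq> c" using k l kl by simp
      then have "v True \<noteq> v False" using S(2) T(2) by (auto simp: D_def split: if_splits)
      then have "\<beta> (v a) (v (\<not> c)) = 0" using iso ac by (cases a; cases c) auto
      moreover have "set (sorted_list_of_set S) \<subseteq> {..<2 * m}"
        "set (sorted_list_of_set ({..<m} - T)) \<subseteq> {..<2 * m}"
        using S(1) fin[OF S(1)] by auto
      ultimately show ?thesis
        unfolding k l f_def g_def using v by (simp add: gen_words_orthogonal)
    next
      case False
      then obtain i where i: "i < m" "i \<in> S \<longleftrightarrow> i \<notin> T" using S(1) T(1) by blast
      show ?thesis
        unfolding k l f_def g_def prod.case
        by (rule word_orthogonal[where i = i]) (use v S(1) T(1) fin i in auto)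
    qed
  qed
qed

section \<open>Existence of vacua from the commuting involutions\<close>

lemma P_E:
  assumes "i < m" "j < m" "x \<in> U"
  shows "P i (E j x) = (if i = j then - E j (P i x) else E j (P i x))"
  using P_word[of i "[j]" x] assms by auto

lemma P_linear:
  "\<lbrakk>i < m; x \<in> U; y \<in> U\<rbrakk> \<Longrightarrow> P i (x + y) = P i x + P i y"
  "\<lbrakk>i < m; x \<in> U\<rbrakk> \<Longrightarrow> P i (c *\<^sub>R x) = c *\<^sub>R P i x"
  "\<lbrakk>i < m; x \<in> U\<rbrakk> \<Longrightarrow> P i (- x) = - P i x"
  by (simp_all add: P_def E_simps)

lemma P_sq:
  assumes "i < m" "x \<in> U"
  shows "P i (P i x) = x"
proof -
  have "\<not> 2 * m - Suc i < m" using assms by linarith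
  then show ?thesis
    using assms by (simp add: P_def E_simps E_sq anticomm[of "2 * m - Suc i" i])
qed

lemma P_mirror:
  assumes "i < m" "j < m" "i \<noteq> j" "x \<in> U"
  shows "P i (E (2 * m - Suc j) x) = E (2 * m - Suc j) (P i x)"
  unfolding P_def using assms
  by (simp add: E_simps anticomm[of "2 * m - Suc i" "2 * m - Suc j"] anticomm[of i "2 * m - Suc j"])

lemma P_comm:
  assumes "i < m" "j < m" "x \<in> U"
  shows "P i (P j x) = P j (P i x)"
proof (cases "i = j")
  case False
  then show ?thesis using assms by (simp add: P_def[of j] P_E P_mirror E_simps)
qed simp

text \<open>As the eigenspaces of each \<open>P i\<close> are isotropic, a nonzero pairing is
  preserved by steering \<open>x\<close> into all eigenspaces for 1 and \<open>y\<close> into all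
  those for -1. The full product then makes a vacuum of \<open>y\<close>.\<close>

lemma exists_vac:
  assumes nd: "nondegenerate_on U b" and U: "U \<noteq> {0}"
  obtains u u' where "u \<in> vac" "u' \<in> vac" "\<beta> u u' \<noteq> 0"
proof -
  obtain x where "x \<in> U" "x \<noteq> 0" using U U_closed(1) by blast
  then obtain y where xy: "x \<in> U" "y \<in> U" "b x y \<noteq> 0" using nd by (auto simp: nondegenerate_on_def)
  have "\<exists>x\<in>U. \<exists>y\<in>U. b x y \<noteq> 0 \<and> (\<forall>i<k. P i x = x \<and> P i y = - y)" if "k \<le> m" for k
    using that
  proof (induction k)
    case 0
    then show ?case using xy by auto
  next
    case (Suc k)
    then obtain x y where x: "x \<in> U" and y: "y \<in> U" and nz: "b x y \<noteq> 0"
      and fix_x: "\<And>i. i < k \<Longrightarrow> P i x = x" and fix_y: "\<And>i. i < k \<Longrightarrow> P i y = - y" by auto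
    have k: "k < m" "k < 2 * m" using Suc by auto
    \<comment> \<open>These are twice the components of \<open>x\<close> in the eigenspaces of
      \<open>P k\<close> for 1 and -1, and likewise for \<open>y\<close> in the next line.\<close>
    define p q where "p = x + P k x" and "q = x - P k x"
    define p' q' where "p' = y + P k y" and "q' = y - P k y"
    have PU: "P k x \<in> U" "P k y \<in> U" using P_closed k x y by auto
    have mem: "p \<in> U" "q \<in> U" "p' \<in> U" "q' \<in> U"
      using PU x y by (auto simp: p_def q_def p'_def q'_def)
    have Pm: "P i (z - z') = P i z - P i z'" if "z \<in> U" "z' \<in> U" "i < m" for i z z'
      using P_linear(1)[of i z "- z'"] P_linear(3)[of i z'] that by simp
    have Pk: "P k p = p" "P k q = - q" "P k p' = p'" "P k q' = - q'"
      using x y k PU by (auto simp: p_def q_def p'_def q'_def P_linear Pm P_sq)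
    have Pi: "P i p = p" "P i q = q" "P i p' = - p'" "P i q' = - q'" if "i < k" for i
      using x y k that PU fix_x fix_y
      by (auto simp: p_def q_def p'_def q'_def P_linear Pm P_comm[of i k])
    have "b p p' = 0" "b q q' = 0"
      using P_anti_selfadjoint[OF k(1) mem(1,3)] P_anti_selfadjoint[OF k(1) mem(2,4)] Pk mem
      by (simp_all add: b_simps)
    moreover have "2 *\<^sub>R x = p + q" "2 *\<^sub>R y = p' + q'"
      by (simp_all add: p_def q_def p'_def q'_def scaleR_2)
    then have "b (p + q) (p' + q') = 4 * b x y"
      using x y by (metis U_closed(5) b_scale_left b_scale_right mult.assoc mult_2 mult_2_right
          numeral_Bit0 distrib_left)
    ultimately have "b p q' + b q p' \<noteq> 0" using nz mem by (simp add: b_simps)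
    then consider "b p q' \<noteq> 0" | "b q p' \<noteq> 0" by force
    then show ?case
    proof cases
      case 1
      have "\<forall>i<Suc k. P i p = p \<and> P i q' = - q'" using Pk Pi by (auto simp: less_Suc_eq)
      then show ?thesis using 1 mem by blast
    next
      case 2
      \<comment> \<open>\<open>E k\<close> is an isometry that exchanges the eigenspaces of
        \<open>P k\<close> and commutes with \<open>P i\<close> for \<open>i < k\<close>, so it
        turns the opposite configuration into the desired one.\<close>
      have "b (E k q) (E k p') = b q p'" using k mem by (simp add: skew E_simps E_sq b_simps)
      moreover have "\<forall>i<Suc k. P i (E k q) = E k q \<and> P i (E k p') = - E k p'"
        using Pk Pi k mem by (auto simp: less_Suc_eq P_E E_simps)
      ultimately show ?thesis using 2 mem k E_closed by metis
    qed
  qed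
  from this[of m] obtain x y where x: "x \<in> U" and y: "y \<in> U" and nz: "b x y \<noteq> 0"
    and P: "\<And>i. i < m \<Longrightarrow> P i x = x" "\<And>i. i < m \<Longrightarrow> P i y = - y" by blast
  let ?F = "foldr E [0..<m]"
  have Fy: "?F y \<in> U" using y full_subset by (simp add: E_simps)
  \<comment> \<open>Every \<open>i < m\<close> occurs in the full product, which therefore flips
    each eigenvalue -1 of \<open>y\<close> to 1.\<close>
  have "P i (?F y) = ?F y" if "i < m" for i
    using that P(2) y full_subset by (subst P_word) (auto simp: E_simps)
  then have "?F y \<in> vac" by (intro vacI Fy)
  moreover have "x \<in> vac" using x P by (intro vacI)
  moreover have "?F (?F y) = ((-1) ^ (length [0..<m] choose 2) * (-1) ^ length [0..<m]) *\<^sub>R y"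
    by (rule word_sq) (use y full_subset in auto)
  then have "\<beta> x (?F y) \<noteq> 0" using nz x y by (simp add: \<beta>_def b_simps)
  ultimately show thesis using that by blast
qed

text \<open>The Boolean index covers both kinds of minimal module at once: a single vacuum is a
  constant family, a hyperbolic pair a non-constant one.\<close>

definition generated :: "(bool \<Rightarrow> 'u) \<Rightarrow> bool" where
  "generated v \<longleftrightarrow> (\<forall>a. v a \<in> vac) \<and> v True \<noteq> 0 \<and> (m mod 4 = 0 \<longrightarrow> v True = v False) \<and>
     U = span (gen_words (range v)) \<and> nondegenerate_on U b"

lemma generatedD:
  assumes "generated v"
  shows "v a \<in> vac" "v True \<noteq> 0" "m mod 4 = 0 \<Longrightarrow> v True = v False"
    "U = span (gen_words (range v))" "nondegenerate_on U b"
  using assms unfolding generated_def by metis+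

lemma \<beta>_symmetric: "m mod 4 = 0 \<Longrightarrow> u \<in> U \<Longrightarrow> u' \<in> U \<Longrightarrow> \<beta> u' u = \<beta> u u'"
  using \<beta>_sym[of u u'] even_Suc_choose_two[of m] by simp

lemma \<beta>_antisymmetric:
  assumes "m mod 4 = 1 \<or> m mod 4 = 2" "u \<in> U" "u' \<in> U"
  shows "\<beta> u' u = - \<beta> u u'"
proof -
  have "(-1) ^ (Suc m choose 2) = (-1::real)"
    using assms(1) even_Suc_choose_two[of m] by (intro minus_one_power_iff[THEN trans]) auto
  then show ?thesis using \<beta>_sym[OF assms(2,3)] by simp
qed

lemma \<beta>_alternating: "m mod 4 = 1 \<or> m mod 4 = 2 \<Longrightarrow> u \<in> U \<Longrightarrow> \<beta> u u = 0"
  using \<beta>_antisymmetric[of u u] by simp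

lemma mod_4_cases:
  assumes "m mod 4 \<noteq> 3"
  obtains "m mod 4 = 0" | "m mod 4 = 1 \<or> m mod 4 = 2"
proof -
  have "m mod 4 < 4" by simp
  then show thesis using assms that by linarith
qed

lemma simple_generated:
  assumes "simple" "m mod 4 \<noteq> 3"
  obtains v where "generated v"
proof -
  have nd: "nondegenerate_on U b" and U: "U \<noteq> {0}" using assms(1) by (auto simp: simple_def)
  obtain u u' where u: "u \<in> vac" "u' \<in> vac" "\<beta> u u' \<noteq> 0" using exists_vac[OF nd U] by blast
  have "\<exists>v. (\<forall>a. v a \<in> vac) \<and> \<beta> (v True) (v False) \<noteq> 0 \<and> (m mod 4 = 0 \<longrightarrow> v True = v False) \<and>
      (v True = v False \<or> (\<forall>a. \<beta> (v a) (v a) = 0))"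
    using assms(2)
  proof (cases rule: mod_4_cases)
    case 1
    \<comment> \<open>By polarisation, a nonzero symmetric pairing has a non-isotropic vector, and
      one vacuum suffices.\<close>
    have "\<exists>x\<in>vac. \<beta> x x \<noteq> 0"
    proof (rule ccontr)
      assume "\<not> (\<exists>x\<in>vac. \<beta> x x \<noteq> 0)"
      then have z: "\<beta> x x = 0" if "x \<in> vac" for x using that by blast
      have "\<beta> (u + u') (u + u') = 2 * \<beta> u u'"
        using u z \<beta>_symmetric[OF 1, of u u'] by (simp add: \<beta>_linear)
      then show False using z[OF vac_add[OF u(1,2)]] u(3) by simp
    qed
    then obtain x where "x \<in> vac" "\<beta> x x \<noteq> 0" by blast
    then show ?thesis by (intro exI[of _ "\<lambda>_. x"]) auto
  next
    case 2
    then have "m mod 4 \<noteq> 0" by auto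
    then show ?thesis
      by (intro exI[of _ "\<lambda>a. if a then u else u'"]) (use u \<beta>_alternating[OF 2] in auto)
  qed
  then obtain v where v': "(\<forall>a. v a \<in> vac) \<and> \<beta> (v True) (v False) \<noteq> 0 \<and>
      (m mod 4 = 0 \<longrightarrow> v True = v False) \<and> (v True = v False \<or> (\<forall>a. \<beta> (v a) (v a) = 0))" ..
  then have v: "\<And>a. v a \<in> vac" "\<beta> (v True) (v False) \<noteq> 0"
    "m mod 4 = 0 \<longrightarrow> v True = v False" "v True = v False \<or> (\<forall>a. \<beta> (v a) (v a) = 0)"
    by simp_all
  let ?X = "span (gen_words (range v))"
  have vU: "range v \<subseteq> U" using v by auto
  have v0: "v True \<noteq> 0"
    using v(1,2) full_subset by (auto simp: \<beta>_def b_zero_left E_simps)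
  have "?X = U"
  proof (rule assms(1)[unfolded simple_def, THEN conjunct2, THEN conjunct2, rule_format], intro conjI allI impI)
    show "?X \<subseteq> U" using gen_words_subset[OF vU] subspace_U by (simp add: span_minimal)
    have "v True \<in> ?X" using gen_words_base[of "range v"] by (auto intro: span_base)
    then show "?X \<noteq> {0}" using v0 by blast
    show "nondegenerate_on ?X b" by (rule nondegenerate_gen_words) (use v in auto)
  qed (auto intro: E_span_gen_words[OF vU, THEN subsetD])
  then show thesis using that[of v] v v0 nd by (simp add: generated_def)
qed

text \<open>Otherwise \<open>v True\<close> would pair to zero under \<beta> with both vacua, hence
  be orthogonal to every word on them and so to all of \<open>U\<close>.\<close>

lemma generated_\<beta>_nonzero:
  assumes v: "generated v" and m: "m mod 4 \<noteq> 3"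
  shows "\<beta> (v True) (v False) \<noteq> 0"
proof
  assume z: "\<beta> (v True) (v False) = 0"
  have vac: "v a \<in> vac" for a using v by (auto simp: generated_def)
  have z': "\<beta> (v True) (v a) = 0" for a
    using m
  proof (cases rule: mod_4_cases)
    case 1
    then show ?thesis using z v by (cases a) (auto simp: generated_def)
  next
    case 2
    then show ?thesis using z \<beta>_alternating[OF 2, of "v True"] vac by (cases a) auto
  qed
  have U: "U = span (gen_words (range v))" and nd: "nondegenerate_on U b" "v True \<noteq> 0"
    using v by (auto simp: generated_def)
  have "b (v True) y = 0" if "y \<in> U" for y
  proof (rule form_eq_on_span[of "{v True}" "gen_words (range v)"])
    fix x z assume "x \<in> {v True}" "z \<in> gen_words (range v)"
    then show "b x z = 0"
      using gen_words_orthogonal[OF vac vac z', of "[]"] by (auto simp: gen_words_def lists_eq_set)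
  next
    have "range v \<subseteq> U" using vac by auto
    then show "{v True} \<subseteq> U" "gen_words (range v) \<subseteq> U"
      using vac gen_words_subset by simp_all
    show "v True \<in> span {v True}" "y \<in> span (gen_words (range v))"
      using that U by (simp_all add: span_base)
  qed
  then show False using nd vac by (auto simp: nondegenerate_on_def)
qed

text \<open>Generation is phrased through invariant subspaces, so that it can be checked for
  modified generators without rewriting words.\<close>

lemma generatedI:
  assumes "\<And>a. v a \<in> vac" "v True \<noteq> 0" "m mod 4 = 0 \<Longrightarrow> v True = v False" "nondegenerate_on U b"
    and "\<And>X. \<lbrakk>subspace X; range v \<subseteq> X; X \<subseteq> U; \<And>i. i < 2 * m \<Longrightarrow> E i ` X \<subseteq> X\<rbrakk> \<Longrightarrow> U \<subseteq> X"
  shows "generated v"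
proof -
  have vU: "range v \<subseteq> U" using assms(1) by auto
  then have "span (gen_words (range v)) \<subseteq> U"
    using gen_words_subset subspace_U by (simp add: span_minimal)
  moreover have "U \<subseteq> span (gen_words (range v))"
    using gen_words_base[of "range v"] span_superset[of "gen_words (range v)"]
    by (intro assms(5) E_span_gen_words[OF vU] calculation) auto
  ultimately show ?thesis using assms(1-4) by (auto simp: generated_def)
qed

lemma generated_subset:
  "\<lbrakk>generated v; subspace X; range v \<subseteq> X; \<And>i. i < 2 * m \<Longrightarrow> E i ` X \<subseteq> X\<rbrakk> \<Longrightarrow> U \<subseteq> X"
  using span_gen_words_subset[of X "range v"] by (simp add: generated_def)

lemma generated_scale:
  assumes v: "generated v" and c: "\<And>a. c a \<noteq> 0" "m mod 4 = 0 \<Longrightarrow> c True = c False"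
  shows "generated (\<lambda>a. c a *\<^sub>R v a)"
proof (rule generatedI)
  fix X assume X: "subspace X" "range (\<lambda>a. c a *\<^sub>R v a) \<subseteq> X" "\<And>i. i < 2 * m \<Longrightarrow> E i ` X \<subseteq> X"
  have "v a \<in> X" for a
    using subspace_scale[OF X(1), of "c a *\<^sub>R v a" "inverse (c a)"] X(2) c(1) by auto
  then show "U \<subseteq> X" using X by (intro generated_subset[OF v]) auto
next
  show "c a *\<^sub>R v a \<in> vac" for a using v vac_scale unfolding generated_def by blast
  show "nondegenerate_on U b" "c True *\<^sub>R v True \<noteq> 0"
    using v c(1) unfolding generated_def by auto
  show "c True *\<^sub>R v True = c False *\<^sub>R v False" if "m mod 4 = 0"
    using v c(2) that unfolding generated_def by metis
qed

end

section \<open>Uniqueness of the modules\<close>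

text \<open>The Gram matrices are compared by applying \<open>split_family.gen_words_orthogonal\<close> to the direct product
  of the two families: the vectors \<open>(v a, w a')\<close> are vacua there, and pair to zero.\<close>

lemma generated_isometry:
  fixes U :: "'u::real_vector set" and W :: "'w::real_vector set"
  assumes "split_family m U E b" "split_family m W F c"
    and v: "split_family.generated m U E b v" and w: "split_family.generated m W F c w"
    and \<beta>: "\<And>i j. split_family.\<beta> m F c (w i) (w j) = s * split_family.\<beta> m E b (v i) (v j)"
    and s: "s \<noteq> 0"
  obtains A where "linear_on U A" "bij_betw A U W" "\<And>i. A (v i) = w i"
    "\<And>i x. i < 2 * m \<Longrightarrow> x \<in> U \<Longrightarrow> A (E i x) = F i (A x)"
    "\<And>x y. x \<in> U \<Longrightarrow> y \<in> U \<Longrightarrow> c (A x) (A y) = s * b x y"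
proof -
  interpret U: split_family m U E b by fact
  interpret W: split_family m W F c by fact
  define G where "G = (\<lambda>i (x, y). (E i x, F i y))"
  \<comment> \<open>A vanishing value of this difference form on two pairs says that the
    corresponding Gram entries of \<open>c\<close> and \<open>b\<close> differ by the factor
    \<open>s\<close>.\<close>
  define d where "d = (\<lambda>p q. s * b (fst p) (fst q) - c (snd p) (snd q))"
  interpret PR: split_family m "U \<times> W" G d
  proof
    show "d x y = d y x" if "x \<in> U \<times> W" "y \<in> U \<times> W" for x y
      using that U.b_sym W.b_sym unfolding d_def by (metis mem_Times_iff)
    show "G i (G j x) = - G j (G i x)" if "i < 2 * m" "j < 2 * m" "i \<noteq> j" "x \<in> U \<times> W" for i j x
      using that U.anticomm[of i j "fst x"] W.anticomm[of i j "snd x"]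
      by (auto simp: G_def split_beta)
    show "d (G i x) y = - d x (G i y)" if "i < 2 * m" "x \<in> U \<times> W" "y \<in> U \<times> W" for i x y
      using that U.skew[of i "fst x" "fst y"] W.skew[of i "snd x" "snd y"]
      by (auto simp: G_def d_def split_beta)
  qed (auto simp: G_def d_def U.E_simps W.E_simps U.E_sq W.E_sq U.b_simps W.b_simps subspace_Times
      U.subspace_U W.subspace_U algebra_simps)
  have foldr_G: "foldr G xs (x, y) = (foldr E xs x, foldr F xs y)" for xs x y
    by (induction xs) (auto simp: G_def)
  have vac: "v i \<in> U.vac" "w i \<in> W.vac" for i
    using U.generatedD(1)[OF v] W.generatedD(1)[OF w] by auto
  have PR_vac: "(v i, w i) \<in> PR.vac" for i
    unfolding PR.vac_def using U.vac_mirror[OF vac(1)[of i]] W.vac_mirror[OF vac(2)[of i]] vac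
    by (auto simp: G_def)
  have PR_\<beta>: "PR.\<beta> (v i, w i) (v j, w j) = 0" for i j
    using \<beta>[of i j] unfolding PR.\<beta>_def U.\<beta>_def W.\<beta>_def by (simp add: foldr_G d_def)
  define I where "I = lists {..<2 * m} \<times> (UNIV :: bool set)"
  define f where "f = (\<lambda>(xs, i). foldr E xs (v i))"
  define g where "g = (\<lambda>(xs, i). foldr F xs (w i))"
  have U: "U = span (f ` I)"
  proof -
    have "f ` I = U.gen_words (range v)"
      unfolding f_def I_def U.gen_words_def by (auto simp: image_iff)
    then show ?thesis using U.generatedD(4)[OF v] by simp
  qed
  have W: "W = span (g ` I)"
  proof -
    have "g ` I = W.gen_words (range w)"
      unfolding g_def I_def W.gen_words_def by (auto simp: image_iff)
    then show ?thesis using W.generatedD(4)[OF w] by simp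
  qed
  have forms: "sym_form U (\<lambda>x y. s * b x y)"
    by unfold_locales (auto simp: U.b_simps U.subspace_U U.b_sym algebra_simps)
  have nd: "nondegenerate_on U (\<lambda>x y. s * b x y)" "nondegenerate_on W c"
    using U.generatedD(5)[OF v] W.generatedD(5)[OF w] s by (simp_all add: nondegenerate_on_def)
  have gram: "c (g k) (g l) = s * b (f k) (f l)" if kl: "k \<in> I" "l \<in> I" for k l
  proof -
    obtain xs i ys j where k: "k = (xs, i)" "l = (ys, j)" by (metis prod.exhaust)
    then have "set xs \<subseteq> {..<2 * m}" "set ys \<subseteq> {..<2 * m}"
      using kl by (auto simp: I_def lists_eq_set)
    from PR.gen_words_orthogonal[OF PR_vac PR_vac PR_\<beta> this, of i j] show ?thesis
      by (simp add: k f_def g_def foldr_G d_def)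
  qed
  obtain A where A: "linear_on U A" "bij_betw A U W" "\<And>k. k \<in> I \<Longrightarrow> A (f k) = g k"
    "\<And>x y. x \<in> U \<Longrightarrow> y \<in> U \<Longrightarrow> c (A x) (A y) = s * b x y"
    by (rule isometry_extension[OF forms W.sym_form_axioms nd U W gram]) (assumption | rule that)+
  have AW: "A x \<in> W" if "x \<in> U" for x using A(2) that by (auto simp: bij_betw_def)
  have AE: "A (E i x) = F i (A x)" if i: "i < 2 * m" and x: "x \<in> U" for i x
  \<comment> \<open>On a spanning word, both sides are the vector obtained by prefixing the letter
    \<open>i\<close>.\<close>
  proof (rule linear_on_eq_on_span[OF _ _ U.subspace_U U _ x])
    show "linear_on U (\<lambda>x. A (E i x))" "linear_on U (\<lambda>x. F i (A x))"
      using linear_onD[OF A(1)] i AW by (simp_all add: linear_on_def U.E_simps W.E_simps)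
    fix z assume "z \<in> f ` I"
    then obtain xs j where z: "z = f (xs, j)" "(xs, j) \<in> I" by auto
    then have "(i # xs, j) \<in> I" using i by (auto simp: I_def)
    from A(3)[OF this] A(3)[OF z(2)] z(1) show "A (E i z) = F i (A z)"
      by (simp add: f_def g_def)
  qed
  have Av: "A (v i) = w i" for i
    using A(3)[of "([], i)"] by (simp add: I_def f_def g_def)
  show thesis by (rule that[OF A(1,2) Av AE A(4)])
qed

text \<open>It remains to match the pairings of the vacua by rescaling \<open>w\<close>. For a
  symmetric pairing, rescaling multiplies by a square, so a sign is left over; for an alternating
  one, a single vector can be rescaled freely.\<close>

lemma generated_similarity:
  fixes U :: "'u::real_vector set" and W :: "'w::real_vector set"
  assumes "split_family m U E b" "split_family m W F c"
    and v: "split_family.generated m U E b v" and w: "split_family.generated m W F c w"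
    and m: "m mod 4 \<noteq> 3"
  obtains A s where "linear_on U A" "bij_betw A U W" "s = 1 \<or> s = (-1::real)"
    "\<And>i x. i < 2 * m \<Longrightarrow> x \<in> U \<Longrightarrow> A (E i x) = F i (A x)"
    "\<And>x y. x \<in> U \<Longrightarrow> y \<in> U \<Longrightarrow> c (A x) (A y) = s * b x y"
proof -
  interpret U: split_family m U E b by fact
  interpret W: split_family m W F c by fact
  have vU: "v i \<in> U" "w i \<in> W" for i
    using U.generatedD(1)[OF v] W.generatedD(1)[OF w] by auto
  define p where "p = U.\<beta> (v True) (v False)"
  define q where "q = W.\<beta> (w True) (w False)"
  have pq: "p \<noteq> 0" "q \<noteq> 0"
    using U.generated_\<beta>_nonzero[OF v m] W.generated_\<beta>_nonzero[OF w m] by (auto simp: p_def q_def)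
  have "\<exists>k s. (\<forall>i. k i \<noteq> 0) \<and> (m mod 4 = 0 \<longrightarrow> k True = k False) \<and> (s = 1 \<or> s = (-1::real)) \<and>
      (\<forall>i j. k i * k j * W.\<beta> (w i) (w j) = s * U.\<beta> (v i) (v j))"
    using m
  proof (cases rule: U.mod_4_cases)
    case 1
    then have eq: "v i = v True" "w i = w True" for i
      using U.generatedD(3)[OF v 1] W.generatedD(3)[OF w 1] by (cases i; simp)+
    \<comment> \<open>Rescaling the vacuum \<open>w\<close> by \<open>l\<close> multiplies
      \<open>q\<close> by \<bar>p / q\<bar>, giving \<open>p\<close> up to the sign of
      \<open>p * q\<close>.\<close>
    define l where "l = sqrt \<bar>p / q\<bar>"
    have "l * l = \<bar>p\<bar> / \<bar>q\<bar>"
      by (simp add: l_def abs_divide)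
    moreover have "q / \<bar>q\<bar> = sgn q" "\<bar>p\<bar> = p * sgn p"
      using pq by (simp_all add: sgn_if abs_if)
    ultimately have "l * l * q = sgn (p * q) * p"
      by (metis (no_types, opaque_lifting) mult.assoc mult.commute sgn_mult times_divide_eq_left
          times_divide_eq_right)
    moreover have "l \<noteq> 0" "sgn (p * q) = 1 \<or> sgn (p * q) = -1"
      using pq by (auto simp: l_def sgn_if)
    moreover have "U.\<beta> (v i) (v j) = p" "W.\<beta> (w i) (w j) = q" for i j
      using eq unfolding p_def q_def by metis+
    ultimately show ?thesis by (intro exI[of _ "\<lambda>_. l"] exI[of _ "sgn (p * q)"]) simp
  next
    case 2
    then have "m mod 4 \<noteq> 0" by auto
    moreover have "U.\<beta> (v i) (v i) = 0" "W.\<beta> (w i) (w i) = 0" for i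
      using U.\<beta>_alternating[OF 2] W.\<beta>_alternating[OF 2] vU by auto
    moreover have "U.\<beta> (v False) (v True) = - p" "W.\<beta> (w False) (w True) = - q"
      using U.\<beta>_antisymmetric[OF 2, of "v True" "v False"]
        W.\<beta>_antisymmetric[OF 2, of "w True" "w False"] vU by (auto simp: p_def q_def)
    ultimately show ?thesis
      using pq unfolding all_bool_eq
      by (intro exI[of _ "\<lambda>i. if i then 1 else p / q"] exI[of _ 1]) (simp add: p_def q_def)
  qed
  then obtain k s where ks: "(\<forall>i. k i \<noteq> 0) \<and> (m mod 4 = 0 \<longrightarrow> k True = k False) \<and>
      (s = 1 \<or> s = (-1::real)) \<and> (\<forall>i j. k i * k j * W.\<beta> (w i) (w j) = s * U.\<beta> (v i) (v j))"
    by (elim exE)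
  then have k: "\<And>i. k i \<noteq> 0" "m mod 4 = 0 \<Longrightarrow> k True = k False"
    and s: "s = 1 \<or> s = -1" "s \<noteq> 0"
    and \<beta>: "\<And>i j. k i * k j * W.\<beta> (w i) (w j) = s * U.\<beta> (v i) (v j)" by auto
  have kw: "W.generated (\<lambda>i. k i *\<^sub>R w i)" by (rule W.generated_scale[OF w k])
  have k\<beta>: "W.\<beta> (k i *\<^sub>R w i) (k j *\<^sub>R w j) = s * U.\<beta> (v i) (v j)" for i j
    using \<beta>[of i j] vU by (simp add: W.\<beta>_linear mult_ac)
  show thesis
    by (rule generated_isometry[OF assms(1,2) v kw k\<beta> s(2)]) (rule that[OF _ _ s(1)])
qed

section \<open>The grading involution and the module of opposite signature\<close>

context split_family
begin

text \<open>The families \<open>E\<close> and \<open>- E\<close> have the same vacua, so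
  \<open>T\<close> arises from uniqueness as an isometry from one to the other. It is an involution
  because its square fixes the generating vacua and commutes with the generators; self-adjointness
  follows.\<close>

lemma grading:
  assumes v: "generated v" and m: "m mod 4 \<noteq> 3"
  obtains T where "linear_on U T" "\<And>x. x \<in> U \<Longrightarrow> T x \<in> U" "\<And>x. x \<in> U \<Longrightarrow> T (T x) = x"
    "\<And>i x. i < 2 * m \<Longrightarrow> x \<in> U \<Longrightarrow> T (E i x) = - E i (T x)"
    "\<And>x y. x \<in> U \<Longrightarrow> y \<in> U \<Longrightarrow> b (T x) y = b x (T y)"
    "\<And>a. \<exists>t. T (v a) = t *\<^sub>R v a"
proof -
  define F where "F = (\<lambda>i x. - E i x)"
  interpret N: split_family m U F b
  proof
    show "F i (F j x) = - F j (F i x)" if "i < 2 * m" "j < 2 * m" "i \<noteq> j" "x \<in> U" for i j x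
      using that anticomm[of i j x] by (simp add: F_def E_simps)
    show "b (F i x) y = - b x (F i y)" if "i < 2 * m" "x \<in> U" "y \<in> U" for i x y
      using that skew[of i x y] by (simp add: F_def E_simps b_simps)
  qed (auto simp: F_def E_simps E_sq)
  \<comment> \<open>Replacing \<open>E\<close> by \<open>- E\<close> multiplies \<beta> by
    \<open>(-1) ^ m\<close>, and \<open>t True * t False\<close> compensates for this. The diagonal
    entries need no correction: they vanish if \<beta> is alternating, and otherwise
    \<open>m\<close> is even.\<close>
  define t :: "bool \<Rightarrow> real" where "t = (\<lambda>a. if a then 1 else (-1) ^ m)"
  have t: "t a * t a = 1" "t a \<noteq> 0" "m mod 4 = 0 \<Longrightarrow> t a = 1" for a
    by (auto simp: t_def minus_one_power_iff)
  have vac: "v a \<in> vac" for a by (rule generatedD(1)[OF v])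
  have gen: "generated (\<lambda>a. t a *\<^sub>R v a)"
    by (rule generated_scale[OF v]) (use t in auto)
  have genN: "N.generated (\<lambda>a. t a *\<^sub>R v a)"
  proof (rule N.generatedI)
    fix X assume X: "subspace X" "range (\<lambda>a. t a *\<^sub>R v a) \<subseteq> X" "\<And>i. i < 2 * m \<Longrightarrow> F i ` X \<subseteq> X"
    have "E i x \<in> X" if "i < 2 * m" "x \<in> X" for i x
      using X(3)[OF that(1)] that(2) subspace_neg[OF X(1), of "- E i x"] by (auto simp: F_def)
    then show "U \<subseteq> X" using X by (intro generated_subset[OF gen]) auto
  next
    fix a
    have "t a *\<^sub>R v a \<in> vac" by (rule generatedD(1)[OF gen])
    then show "t a *\<^sub>R v a \<in> N.vac"
      unfolding N.vac_def using vac_mirror by (auto simp: F_def)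
  qed (use generatedD[OF gen] in auto)
  have foldr_F: "foldr F xs x = (-1) ^ length xs *\<^sub>R foldr E xs x"
    if "x \<in> U" "set xs \<subseteq> {..<2 * m}" for xs x
    using that(2) by (induction xs) (auto simp: F_def E_simps that(1))
  have \<beta>: "N.\<beta> (t i *\<^sub>R v i) (t j *\<^sub>R v j) = 1 * \<beta> (v i) (v j)" for i j
  proof -
    have "N.\<beta> (t i *\<^sub>R v i) (t j *\<^sub>R v j) = t i * t j * (-1) ^ m * \<beta> (v i) (v j)"
      unfolding N.\<beta>_def \<beta>_def using vac full_subset foldr_F[of "t j *\<^sub>R v j" "[0..<m]"]
      by (simp add: E_simps b_simps)
    moreover have "t i * t j * (-1) ^ m = 1 \<or> \<beta> (v i) (v j) = 0"
      using m
    proof (cases rule: mod_4_cases)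
      case 1
      then have "even m" by (metis dvd_trans even_numeral mod_0_imp_dvd)
      then show ?thesis by (simp add: t_def)
    next
      case 2
      show ?thesis
        using \<beta>_alternating[OF 2, of "v i"] vac
        by (cases "i = j") (auto simp: t_def minus_one_power_iff)
    qed
    ultimately show ?thesis by auto
  qed
  obtain T where T: "linear_on U T" "bij_betw T U U" "\<And>a. T (v a) = t a *\<^sub>R v a"
    "\<And>i x. i < 2 * m \<Longrightarrow> x \<in> U \<Longrightarrow> T (E i x) = F i (T x)"
    "\<And>x y. x \<in> U \<Longrightarrow> y \<in> U \<Longrightarrow> b (T x) (T y) = 1 * b x y"
    by (rule generated_isometry[OF split_family_axioms N.split_family_axioms v genN \<beta> one_neq_zero])
      blast
  have TU: "T x \<in> U" if "x \<in> U" for x using T(2) that by (auto simp: bij_betw_def)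
  have Tminus: "T (- x) = - T x" if "x \<in> U" for x
    using linear_onD(2)[OF T(1) that, of "-1"] by simp
  have TT: "T (T x) = x" if "x \<in> U" for x
  proof -
    let ?X = "{x \<in> U. T (T x) = x}"
    have "U \<subseteq> ?X"
    proof (rule generated_subset[OF v])
      show "subspace ?X"
        using linear_onD[OF T(1)] linear_onD(2)[OF T(1), of 0 0] TU by (auto simp: subspace_def)
      show "range v \<subseteq> ?X"
        using vac T(3) linear_onD(2)[OF T(1)] t(1) by auto
      show "E i ` ?X \<subseteq> ?X" if "i < 2 * m" for i
        using that T(4) TU Tminus by (auto simp: E_simps F_def)
    qed
    then show ?thesis using that by auto
  qed
  show thesis
  proof (rule that[of T])
    show "b (T x) y = b x (T y)" if "x \<in> U" "y \<in> U" for x y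
      using T(5)[of x "T y"] TT TU that by simp
  qed (use T TU TT in \<open>auto simp: F_def\<close>)
qed

end

context split_family
begin

text \<open>As \<open>T\<close> anticommutes with every generator, composing with \<open>T\<close>
  negates the squares, and reversing the indices puts the squares -1 first again. The reversal also
  respects the relation defining vacua.\<close>

lemma reversal:
  assumes v: "generated v" and m: "m mod 4 \<noteq> 3"
  obtains T where "linear_on U T" "\<And>x. x \<in> U \<Longrightarrow> T x \<in> U" "\<And>x. x \<in> U \<Longrightarrow> T (T x) = x"
    "\<And>i x. i < 2 * m \<Longrightarrow> x \<in> U \<Longrightarrow> T (E i x) = - E i (T x)"
    "split_family m U (\<lambda>i x. T (E (2 * m - Suc i) x)) (\<lambda>x y. b (T x) y)"
    "split_family.generated m U (\<lambda>i x. T (E (2 * m - Suc i) x)) (\<lambda>x y. b (T x) y) v"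
proof -
  obtain T where T: "linear_on U T" and TU: "\<And>x. x \<in> U \<Longrightarrow> T x \<in> U"
    and TT: "\<And>x. x \<in> U \<Longrightarrow> T (T x) = x"
    and TE: "\<And>i x. i < 2 * m \<Longrightarrow> x \<in> U \<Longrightarrow> T (E i x) = - E i (T x)"
    and Tb: "\<And>x y. x \<in> U \<Longrightarrow> y \<in> U \<Longrightarrow> b (T x) y = b x (T y)"
    and Tv: "\<And>a. \<exists>t. T (v a) = t *\<^sub>R v a"
    by (rule grading[OF v m]) (rule that)
  note T_lin = linear_onD[OF T]
  have Tm: "T (- x) = - T x" if "x \<in> U" for x using T_lin(2)[OF that, of "-1"] by simp
  define G where "G = (\<lambda>i x. T (E (2 * m - Suc i) x))"
  define d where "d = (\<lambda>x y. b (T x) y)"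
  have \<rho>: "2 * m - Suc i < 2 * m" "2 * m - Suc (2 * m - Suc i) = i"
    "i < m \<longleftrightarrow> \<not> 2 * m - Suc i < m" if "i < 2 * m" for i
    using that by auto
  have GG: "G i (G j x) = - E (2 * m - Suc i) (E (2 * m - Suc j) x)"
    if "i < 2 * m" "j < 2 * m" "x \<in> U" for i j x
    using that by (simp add: G_def TE TT TU Tm E_simps)
  have TG: "T (G i x) = - G i (T x)" "T (G i x) = E (2 * m - Suc i) x"
    if "i < 2 * m" "x \<in> U" for i x
    using that by (simp_all add: G_def TE TT TU E_simps Tm)
  have split: "split_family m U G d"
  proof
    show "d x y = d y x" if "x \<in> U" "y \<in> U" for x y
      using that b_sym[of x "T y"] by (simp add: d_def Tb TU)
    show "G i (G i x) = - ((if i < m then 1 else - 1) *\<^sub>R x)" if "i < 2 * m" "x \<in> U" for i x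
      using that \<rho>(3)[OF that(1)] by (simp add: GG E_sq)
    show "G i (G j x) = - G j (G i x)" if "i < 2 * m" "j < 2 * m" "i \<noteq> j" "x \<in> U" for i j x
      using that by (simp add: GG anticomm[of "2 * m - Suc i" "2 * m - Suc j" x])
    show "d (G i x) y = - d x (G i y)" if "i < 2 * m" "x \<in> U" "y \<in> U" for i x y
    proof -
      have "d (G i x) y = - b x (E (2 * m - Suc i) y)"
        using that by (simp add: d_def TG(2) skew)
      also have "\<dots> = - d x (G i y)"
        using that by (simp add: d_def Tb TG(2) G_def TT TU E_simps)
      finally show ?thesis .
    qed
  qed (auto simp: G_def d_def T_lin TU E_simps b_simps subspace_U)
  then interpret R: split_family m U G d .
  have gen: "R.generated v"
  proof (rule R.generatedI)
    show "v a \<in> R.vac" for a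
      unfolding R.vac_def
    proof (intro CollectI conjI allI impI)
      show "G (2 * m - Suc i) (v a) = - G i (v a)" if "i < m" for i
        using that \<rho>[of i] vac_mirror[OF generatedD(1)[OF v], of i a] generatedD(1)[OF v, of a]
        by (simp add: G_def Tm E_simps)
    qed (use generatedD(1)[OF v] in simp)
    show "nondegenerate_on U d"
      unfolding nondegenerate_on_def
    proof (intro ballI impI)
      fix x assume x: "x \<in> U" "\<forall>y\<in>U. d x y = 0"
      then have "T x = 0"
        using generatedD(5)[OF v] TU unfolding nondegenerate_on_def d_def by blast
      then show "x = 0" using TT[OF x(1)] T_lin(2)[of 0 0] by simp
    qed
    fix X assume X: "subspace X" "range v \<subseteq> X" "X \<subseteq> U" "\<And>i. i < 2 * m \<Longrightarrow> G i ` X \<subseteq> X"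
    \<comment> \<open>Invariance of \<open>X\<close> under \<open>T\<close> is not known. The part
      of \<open>X\<close> that \<open>T\<close> maps into \<open>X\<close> is invariant under the
      original generators, because \<open>E i\<close> and \<open>T E i\<close> are new generators
      applied to \<open>T x\<close> and \<open>x\<close>, up to sign.\<close>
    have "U \<subseteq> {x \<in> X. T x \<in> X}"
    proof (rule generated_subset[OF v])
      show "subspace {x \<in> X. T x \<in> X}"
        using X(1,3) T_lin T_lin(2)[of 0 0] by (auto simp: subspace_def subset_iff)
      show "range v \<subseteq> {x \<in> X. T x \<in> X}"
      proof safe
        fix a
        show va: "v a \<in> X" using X(2) by auto
        obtain t where "T (v a) = t *\<^sub>R v a" using Tv by blast
        then show "T (v a) \<in> X" using va X(1) by (simp add: subspace_scale)
      qed
      show "E i ` {x \<in> X. T x \<in> X} \<subseteq> {x \<in> X. T x \<in> X}" if i: "i < 2 * m" for i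
      proof safe
        fix x assume x: "x \<in> X" "T x \<in> X"
        let ?j = "2 * m - Suc i"
        have j: "?j < 2 * m" using i by simp
        have "x \<in> U" using x X(3) by auto
        then have E: "E i x = - G ?j (T x)" "T (E i x) = G ?j x"
          using TG[OF j, of x] i \<rho>(2)[OF i] by (auto simp: G_def)
        show "E i x \<in> X" unfolding E(1) using X(4)[OF j] x subspace_neg[OF X(1)] by auto
        show "T (E i x) \<in> X" unfolding E(2) using X(4)[OF j] x by auto
      qed
    qed
    then show "U \<subseteq> X" by blast
  qed (use generatedD[OF v] in auto)
  show thesis
    by (rule that[OF T TU TT TE split[unfolded G_def d_def] gen[unfolded G_def d_def]])
qed

end

section \<open>Flipping the signs of the squares of generators\<close>

text \<open>If \<open>\<omega>\<close> is the product of the generators indexed by \<open>Ns\<close>, a multiple of four with squares of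
  the same sign, then \<open>\<omega>\<close> is a self-adjoint involution, and passing to the generators \<open>\<omega> (E i x)\<close>
  for \<open>i\<close> in \<open>Ns\<close> and to the form \<open>b (\<omega> x) y\<close> changes the signature without changing the
  submodules.\<close>

locale flipped_family = clifford_family n U E \<epsilon> b
  for n :: nat and U :: "'u::real_vector set" and E \<epsilon> b +
  fixes Ns :: "nat list" and e :: real
  assumes Ns: "distinct Ns" "set Ns \<subseteq> {..<n}" "4 dvd length Ns" "\<And>i. i \<in> set Ns \<Longrightarrow> \<epsilon> i = e"
begin

definition \<omega> :: "'u \<Rightarrow> 'u" where "\<omega> = foldr E Ns"

definition FE :: "nat \<Rightarrow> 'u \<Rightarrow> 'u" where
  "FE i x = (if i \<in> set Ns then \<omega> (E i x) else E i x)"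

definition F\<epsilon> :: "nat \<Rightarrow> real" where "F\<epsilon> i = (if i \<in> set Ns then - \<epsilon> i else \<epsilon> i)"

definition Fb :: "'u \<Rightarrow> 'u \<Rightarrow> real" where "Fb x y = b (\<omega> x) y"

lemma \<omega>_simps:
  "x \<in> U \<Longrightarrow> \<omega> x \<in> U" "x \<in> U \<Longrightarrow> y \<in> U \<Longrightarrow> \<omega> (x + y) = \<omega> x + \<omega> y"
  "x \<in> U \<Longrightarrow> \<omega> (c *\<^sub>R x) = c *\<^sub>R \<omega> x" "x \<in> U \<Longrightarrow> \<omega> (- x) = - \<omega> x"
  using Ns(2) by (simp_all add: \<omega>_def E_simps)

lemma power_length: "e ^ length Ns = 1"
proof (cases "Ns = []")
  case False
  then obtain i where "i \<in> set Ns" by (cases Ns) auto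
  then have "e * e = 1" using eps[of i] Ns(2,4) by auto
  moreover obtain k where k: "length Ns = 4 * k" using Ns(3) by blast
  ultimately show ?thesis by (simp add: power_mult power4_eq_xxxx)
qed simp

lemma even_length: "even (length Ns)"
  using Ns(3) by (rule dvd_trans[rotated]) simp

lemma \<omega>_\<omega>: "x \<in> U \<Longrightarrow> \<omega> (\<omega> x) = x"
proof -
  assume x: "x \<in> U"
  obtain k where k: "length Ns = 4 * k" using Ns(3) by blast
  have "even (length Ns choose 2)" by (simp add: choose_two k)
  then have "(-1) ^ (length Ns choose 2) * (- e) ^ length Ns = 1"
    using even_length power_length by simp
  then show ?thesis using word_sq[of Ns e x] Ns x by (simp add: \<omega>_def)
qed

lemma E_\<omega>:
  assumes "i < n" "x \<in> U"
  shows "\<omega> (E i x) = (if i \<in> set Ns then - E i (\<omega> x) else E i (\<omega> x))"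
  using E_word_in[of i Ns x] E_word_notin[of i Ns x] assms Ns(1,2) even_length by (simp add: \<omega>_def)

lemma b_\<omega>:
  assumes "x \<in> U" "y \<in> U"
  shows "b (\<omega> x) y = b x (\<omega> y)"
proof -
  have "map \<epsilon> Ns = map (\<lambda>_. e) Ns" using Ns(4) by (intro map_cong) auto
  then have "(\<Prod>i\<leftarrow>Ns. \<epsilon> i) = 1" using power_length by (simp add: map_replicate_const)
  then have "b (\<omega> (\<omega> x)) (\<omega> y) = b (\<omega> x) y"
    using word_isometry[of Ns "\<omega> x" y] Ns(2) assms \<omega>_simps(1)[OF assms(1)] by (simp add: \<omega>_def)
  then show ?thesis using \<omega>_\<omega> assms by simp
qed

text \<open>The length of \<open>Ns\<close> being even, \<omega> anticommutes with the generators in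
  \<open>Ns\<close> and commutes with the others, so exactly the squares belonging to
  \<open>Ns\<close> change sign.\<close>

sublocale F: clifford_family n U FE F\<epsilon> Fb
proof
  show "Fb x y = Fb y x" if "x \<in> U" "y \<in> U" for x y
    using that b_sym[of x "\<omega> y"] by (simp add: Fb_def b_\<omega> \<omega>_simps)
  show "FE i (FE j x) = - FE j (FE i x)" if "i < n" "j < n" "i \<noteq> j" "x \<in> U" for i j x
    using that anticomm[of i j x] anticomm[of i j "\<omega> x"]
    by (auto simp: FE_def E_\<omega> \<omega>_simps E_simps \<omega>_\<omega>)
  show "Fb (FE i x) y = - Fb x (FE i y)" if "i < n" "x \<in> U" "y \<in> U" for i x y
  proof (cases "i \<in> set Ns")
    case True
    then show ?thesis
      using that by (simp add: Fb_def FE_def b_\<omega> \<omega>_\<omega> \<omega>_simps E_simps skew)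
  next
    case False
    then show ?thesis
      using that by (simp add: Fb_def FE_def E_\<omega> \<omega>_simps E_simps skew)
  qed
  show "F\<epsilon> i * F\<epsilon> i = 1" if "i < n" for i using eps[OF that] by (simp add: F\<epsilon>_def)
qed (auto simp: Fb_def FE_def F\<epsilon>_def \<omega>_simps E_simps b_simps E_\<omega> E_sq \<omega>_\<omega> subspace_U)

text \<open>Two different twisted factors satisfy (\<omega> E i) (\<omega> E j) = - E i E j. Hence
  \<omega> is also a product of twisted generators, and the twist can be undone inside any subspace
  invariant under them.\<close>

lemma foldr_FE:
  assumes "x \<in> U"
  shows "foldr FE Ns x = \<omega> x"
proof -
  obtain k where k: "length Ns = 4 * k" using Ns(3) by blast
  show ?thesis
    unfolding \<omega>_def
    by (rule foldr_negated_pairs[OF _ _ _ Ns(1) k assms])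
      (use Ns(2) in \<open>auto simp: FE_def E_\<omega> \<omega>_\<omega> \<omega>_simps E_simps subset_iff\<close>)
qed

lemma \<omega>_FE: "i \<in> set Ns \<Longrightarrow> x \<in> U \<Longrightarrow> \<omega> (FE i x) = E i x"
  using Ns(2) by (auto simp: FE_def \<omega>_\<omega> E_simps)

lemma simple_flip:
  assumes "simple"
  shows "F.simple"
  unfolding F.simple_def
proof (intro conjI allI impI)
  have s: "U \<noteq> {0}" "nondegenerate_on U b"
    "\<And>X. subspace X \<and> X \<subseteq> U \<and> X \<noteq> {0} \<and> (\<forall>i<n. E i ` X \<subseteq> X) \<and> nondegenerate_on X b \<Longrightarrow> X = U"
    using assms by (auto simp: simple_def)
  show "U \<noteq> {0}" by fact
  show "nondegenerate_on U Fb"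
    unfolding nondegenerate_on_def
  proof (intro ballI impI)
    fix x assume x: "x \<in> U" "\<forall>y\<in>U. Fb x y = 0"
    then have "\<omega> x = 0" using s(2) \<omega>_simps(1) unfolding nondegenerate_on_def Fb_def by blast
    then show "x = 0" using \<omega>_\<omega>[OF x(1)] \<omega>_simps(3)[of 0 0] by simp
  qed
  fix X assume X: "subspace X \<and> X \<subseteq> U \<and> X \<noteq> {0} \<and> (\<forall>i<n. FE i ` X \<subseteq> X) \<and> nondegenerate_on X Fb"
  have \<omega>X: "\<omega> x \<in> X" if "x \<in> X" for x
    using F.word_invariant[of X Ns x] X Ns(2) that foldr_FE[of x] by auto
  show "X = U"
  proof (rule s(3), intro conjI allI impI)
    show "E i ` X \<subseteq> X" if i: "i < n" for i
    proof safe
      fix x assume x: "x \<in> X"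
      then have FX: "FE i x \<in> X" and xU: "x \<in> U" using X i by blast+
      show "E i x \<in> X"
      proof (cases "i \<in> set Ns")
        case True
        then show ?thesis using \<omega>X[OF FX] \<omega>_FE xU by simp
      next
        case False
        then show ?thesis using FX by (simp add: FE_def)
      qed
    qed
    show "nondegenerate_on X b"
      unfolding nondegenerate_on_def
    proof (intro ballI impI)
      fix x assume x: "x \<in> X" "\<forall>y\<in>X. b x y = 0"
      have "Fb x y = 0" if "y \<in> X" for y
      proof -
        have "x \<in> U" "y \<in> U" using x(1) that X by auto
        then show ?thesis unfolding Fb_def using x(2) \<omega>X[OF that] by (simp add: b_\<omega>)
      qed
      then show "x = 0" using X x(1) unfolding nondegenerate_on_def by blast
    qed
  qed (use X in auto)
qed

end

section \<open>Comparing modules of opposite signatures\<close>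

lemma clifford_family_cong:
  assumes "clifford_family n U E \<epsilon> b" "\<And>i. i < n \<Longrightarrow> \<epsilon> i = \<epsilon>' i"
  shows "clifford_family n U E \<epsilon>' b"
proof -
  interpret clifford_family n U E \<epsilon> b by fact
  show ?thesis
  proof (intro clifford_family.intro clifford_family_axioms.intro)
    show "\<epsilon>' i * \<epsilon>' i = 1" if "i < n" for i using eps[OF that] assms(2)[OF that] by simp
    show "E i (E i x) = - (\<epsilon>' i *\<^sub>R x)" if "i < n" "x \<in> U" for i x
      using E_sq[OF that] assms(2)[OF that(1)] by simp
  qed (fact sym_form_axioms E_closed E_add E_scale anticomm skew)+
qed

text \<open>The map \<open>A\<close> need be neither an isometry nor an intertwiner for the
  untwisted data. The trilinear expression in the conclusion is all that the bracket depends on, and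
  in it both the twists and \<open>T\<close> cancel.\<close>

lemma reversing_similarity:
  fixes U :: "'u::real_vector set" and W :: "'w::real_vector set"
  assumes "flipped_family (2 * m) U E \<epsilon> b (map (\<lambda>i. 2 * m - Suc i) Ns) e"
    and "flipped_family (2 * m) W F \<delta> c Ns d"
    and simple: "clifford_family.simple (2 * m) U E b" "clifford_family.simple (2 * m) W F c"
    and \<delta>: "\<And>i. i < 2 * m \<Longrightarrow> (if i \<in> set Ns then - \<delta> i else \<delta> i) = (if i < m then 1 else -1)"
    and \<epsilon>: "\<And>i. i < 2 * m \<Longrightarrow> \<epsilon> (2 * m - Suc i) = - \<delta> i"
    and m: "m mod 4 \<noteq> 3"
  obtains A s where "linear_on U A" "bij_betw A U W" "s = 1 \<or> s = (-1::real)"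
    "\<And>i x y. i < 2 * m \<Longrightarrow> x \<in> U \<Longrightarrow> y \<in> U \<Longrightarrow>
      c (F i (A x)) (A y) = s * b (E (2 * m - Suc i) x) y"
proof -
  let ?\<rho> = "\<lambda>i. 2 * m - Suc i"
  interpret V: flipped_family "2 * m" U E \<epsilon> b "map ?\<rho> Ns" e by fact
  interpret W: flipped_family "2 * m" W F \<delta> c Ns d by fact
  have \<rho>: "?\<rho> i < 2 * m" "?\<rho> (?\<rho> i) = i" "i < m \<longleftrightarrow> \<not> ?\<rho> i < m" if "i < 2 * m" for i
    using that by auto
  have inj: "inj_on ?\<rho> {..<2 * m}" by (rule inj_onI) auto
  have mem: "?\<rho> i \<in> set (map ?\<rho> Ns) \<longleftrightarrow> i \<in> set Ns" if "i < 2 * m" for i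
    using inj_on_image_mem_iff[OF inj _ W.Ns(2), of i] that by simp
  have "V.F\<epsilon> i = (if i < m then 1 else - 1)" if i: "i < 2 * m" for i
  proof -
    have "V.F\<epsilon> (?\<rho> (?\<rho> i)) = - (if ?\<rho> i \<in> set Ns then - \<delta> (?\<rho> i) else \<delta> (?\<rho> i))"
      unfolding V.F\<epsilon>_def using mem[OF \<rho>(1)[OF i]] \<epsilon>[OF \<rho>(1)[OF i]] by simp
    then show ?thesis using \<delta>[OF \<rho>(1)[OF i]] \<rho>(2,3)[OF i] by simp
  qed
  then interpret VS: split_family m U V.FE V.Fb
    unfolding split_family_def by (rule clifford_family_cong[OF V.F.clifford_family_axioms])
  have "W.F\<epsilon> i = (if i < m then 1 else - 1)" if i: "i < 2 * m" for i
    using \<delta>[OF i] by (simp add: W.F\<epsilon>_def)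
  then interpret WS: split_family m W W.FE W.Fb
    unfolding split_family_def by (rule clifford_family_cong[OF W.F.clifford_family_axioms])
  obtain v where v: "VS.generated v"
    by (rule VS.simple_generated[OF V.simple_flip[OF simple(1)] m])
  obtain w where w: "WS.generated w"
    by (rule WS.simple_generated[OF W.simple_flip[OF simple(2)] m])
  obtain T where T: "linear_on U T" "\<And>x. x \<in> U \<Longrightarrow> T x \<in> U" "\<And>x. x \<in> U \<Longrightarrow> T (T x) = x"
    and TE: "\<And>i x. i < 2 * m \<Longrightarrow> x \<in> U \<Longrightarrow> T (V.FE i x) = - V.FE i (T x)"
    and G: "split_family m U (\<lambda>i x. T (V.FE (?\<rho> i) x)) (\<lambda>x y. V.Fb (T x) y)"
    "split_family.generated m U (\<lambda>i x. T (V.FE (?\<rho> i) x)) (\<lambda>x y. V.Fb (T x) y) v"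
    by (rule VS.reversal[OF v m]) (rule that)
  have Tm: "T (- x) = - T x" if "x \<in> U" for x
    using linear_onD(2)[OF T(1) that, of "-1"] by simp
  define G' where "G' = (\<lambda>i x. T (V.FE (?\<rho> i) x))"
  obtain A s where A: "linear_on U A" "bij_betw A U W" and s: "s = 1 \<or> s = (-1::real)"
    and AG: "\<And>i x. i < 2 * m \<Longrightarrow> x \<in> U \<Longrightarrow> A (G' i x) = W.FE i (A x)"
    and Ab: "\<And>x y. x \<in> U \<Longrightarrow> y \<in> U \<Longrightarrow> W.Fb (A x) (A y) = s * V.Fb (T x) y"
    by (rule generated_similarity[OF G(1)[folded G'_def] WS.split_family_axioms G(2)[folded G'_def] w m])
      (rule that)
  have AW: "A x \<in> W" if "x \<in> U" for x using A(2) that by (auto simp: bij_betw_def)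
  have G'U: "G' i x \<in> U" if "i < 2 * m" "x \<in> U" for i x
    using that T(2) \<rho>(1) by (simp add: G'_def V.F.E_closed)
  \<comment> \<open>\<open>T\<close> anticommutes with each twisted generator, and \<omega> is a
    product of an even number of them.\<close>
  have T\<omega>: "T (V.\<omega> x) = V.\<omega> (T x)" if x: "x \<in> U" for x
  proof -
    have "T (foldr V.FE xs x) = (-1) ^ length xs *\<^sub>R foldr V.FE xs (T x)"
      if "set xs \<subseteq> {..<2 * m}" for xs
      using that by (induction xs) (auto simp: TE x T(2) V.F.E_simps)
    from this[OF V.Ns(2)] show ?thesis
      using V.foldr_FE x T(2) V.even_length by simp
  qed
  have A\<omega>: "A (V.\<omega> x) = W.\<omega> (A x)" if x: "x \<in> U" for x
  proof -
    obtain k where k: "length Ns = 4 * k" using W.Ns(3) by blast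
    have sub: "i < 2 * m" if "i \<in> set Ns" for i using that W.Ns(2) by auto
    have G'_word: "foldr G' xs x \<in> U \<and> A (foldr G' xs x) = foldr W.FE xs (A x)"
      if "set xs \<subseteq> {..<2 * m}" for xs
      using that by (induction xs) (auto simp: AG G'U x)
    \<comment> \<open>The map \<open>A\<close> intertwines words in \<open>G'\<close>, not in
      \<open>V.FE\<close>. Removing the involution \<open>T\<close> costs one sign per pair of
      letters, which cancels over a multiple of four.\<close>
    have "foldr G' Ns x = foldr (\<lambda>i. V.FE (?\<rho> i)) Ns x"
    proof (rule foldr_negated_pairs[OF _ _ _ W.Ns(1) k x])
      fix i j z assume ij: "i \<in> set Ns" "j \<in> set Ns" and z: "z \<in> U"
      show "G' i z \<in> U" by (intro G'U sub ij z)
      show "V.FE (?\<rho> i) z \<in> U \<and> V.FE (?\<rho> i) (- z) = - V.FE (?\<rho> i) z"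
        using \<rho>(1)[OF sub[OF ij(1)]] z by (simp add: V.F.E_simps)
      show "G' i (G' j z) = - V.FE (?\<rho> i) (V.FE (?\<rho> j) z)"
        using \<rho>(1)[OF sub[OF ij(1)]] \<rho>(1)[OF sub[OF ij(2)]] z
        by (simp add: G'_def TE T(2,3) Tm V.F.E_simps)
    qed
    also have "\<dots> = V.\<omega> x" using V.foldr_FE[OF x] by (simp add: foldr_map comp_def)
    finally show ?thesis
      using G'_word[OF W.Ns(2)] W.foldr_FE[OF AW[OF x]] by simp
  qed
  have "c (F i (A x)) (A y) = s * b (E (?\<rho> i) x) y" if i: "i < 2 * m" and x: "x \<in> U" and y: "y \<in> U"
    for i x y
  proof -
    have TG: "T (G' i x) = V.FE (?\<rho> i) x" using i x by (simp add: G'_def T(3) V.F.E_closed)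
    have FU: "V.FE (?\<rho> i) x \<in> U" "W.FE i (A x) \<in> W"
      using i x AW \<rho>(1) by (simp_all add: V.F.E_closed W.F.E_closed)
    \<comment> \<open>For \<open>i\<close> in \<open>Ns\<close> the twists of generator and form
      cancel. Otherwise \<omega> is inserted twice: one copy is absorbed by the form, the other is
      carried through \<open>A\<close> and \<open>T\<close>, and at the end the two copies cancel
      again.\<close>
    show ?thesis
    proof (cases "i \<in> set Ns")
      case True
      then have "c (F i (A x)) (A y) = W.Fb (W.FE i (A x)) (A y)"
        using W.\<omega>_FE[OF True AW[OF x]] by (simp add: W.Fb_def)
      also have "\<dots> = s * V.Fb (V.FE (?\<rho> i) x) y"
        using Ab[OF G'U[OF i x] y] AG[OF i x] TG by simp
      also have "V.Fb (V.FE (?\<rho> i) x) y = b (E (?\<rho> i) x) y"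
        using V.\<omega>_FE[OF _ x] mem[OF i] True by (simp add: V.Fb_def)
      finally show ?thesis .
    next
      case False
      then have "c (F i (A x)) (A y) = W.Fb (W.\<omega> (W.FE i (A x))) (A y)"
        using W.\<omega>_\<omega>[OF FU(2)] by (simp add: W.Fb_def W.FE_def)
      also have "\<dots> = s * V.Fb (V.\<omega> (V.FE (?\<rho> i) x)) y"
        using Ab[OF V.\<omega>_simps(1)[OF G'U[OF i x]] y] A\<omega>[OF G'U[OF i x]] AG[OF i x] TG
          T\<omega>[OF G'U[OF i x]] by simp
      also have "V.Fb (V.\<omega> (V.FE (?\<rho> i) x)) y = b (E (?\<rho> i) x) y"
        using V.\<omega>_\<omega>[OF FU(1)] mem[OF i] False by (simp add: V.Fb_def V.FE_def)
      finally show ?thesis .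
    qed
  qed
  then show thesis by (rule that[OF A s])
qed

section \<open>The Lie algebras\<close>

lemma sp_single:
  assumes "i < r + s"
  shows "sp r s (Poly_Mapping.single i 1) u = (if i < r then 1 else -1) * Poly_Mapping.lookup u i"
proof -
  have "sp r s (Poly_Mapping.single i 1) u =
      (\<Sum>j<r + s. if i = j then (if j < r then 1 else -1) * Poly_Mapping.lookup u j else 0)"
    unfolding sp_eq by (intro sum.cong) (auto simp: lookup_single when_def)
  then show ?thesis using assms by simp
qed

lemma sp_add_left: "sp r s (x + y) z = sp r s x z + sp r s y z"
  by (simp add: sp_eq lookup_add distrib_right sum.distrib)

section \<open>Clifford families of admissible modules\<close>

context
  fixes r s :: nat and U :: "'u::real_vector set" and J b
  assumes adm: "admissible_module r s U J b"
begin

lemma admissible_moduleD: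
  "finite_dim_subspace U" "subspace U" "scalar_product_on U b"
  "z \<in> Rspace r s \<Longrightarrow> linear_endo_on U (J z)"
  "x \<in> U \<Longrightarrow> linear_on (Rspace r s) (\<lambda>z. J z x)"
  "z \<in> Rspace r s \<Longrightarrow> x \<in> U \<Longrightarrow> J z (J z x) = - (sp r s z z *\<^sub>R x)"
  "z \<in> Rspace r s \<Longrightarrow> x \<in> U \<Longrightarrow> y \<in> U \<Longrightarrow> b (J z x) y + b x (J z y) = 0"
proof -
  note cm = adm[unfolded admissible_module_def clifford_module_def]
  show fin: "finite_dim_subspace U" and "scalar_product_on U b" using cm by blast+
  show "subspace U" using fin unfolding finite_dim_subspace_def by blast
  show "z \<in> Rspace r s \<Longrightarrow> linear_endo_on U (J z)" using cm by blast
  show "x \<in> U \<Longrightarrow> linear_on (Rspace r s) (\<lambda>z. J z x)" using cm by blast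
  show "z \<in> Rspace r s \<Longrightarrow> x \<in> U \<Longrightarrow> J z (J z x) = - (sp r s z z *\<^sub>R x)" using cm by blast
  show "z \<in> Rspace r s \<Longrightarrow> x \<in> U \<Longrightarrow> y \<in> U \<Longrightarrow> b (J z x) y + b x (J z y) = 0" using cm by blast
qed

lemma admissible_formD:
  "x \<in> U \<Longrightarrow> y \<in> U \<Longrightarrow> z \<in> U \<Longrightarrow> b (x + y) z = b x z + b y z"
  "x \<in> U \<Longrightarrow> z \<in> U \<Longrightarrow> b (c *\<^sub>R x) z = c * b x z"
  "x \<in> U \<Longrightarrow> y \<in> U \<Longrightarrow> b x y = b y x"
  "nondegenerate_on U b"
proof -
  note sp = admissible_moduleD(3)[unfolded scalar_product_on_def]
  have lin: "linear_on U (\<lambda>x. b x z)" if "z \<in> U" for z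
    using sp[THEN conjunct1] that by (rule bspec)
  show "b (x + y) z = b x z + b y z" if "x \<in> U" "y \<in> U" "z \<in> U"
    using linear_onD(1)[OF lin[OF that(3)] that(1,2)] .
  show "b (c *\<^sub>R x) z = c * b x z" if "x \<in> U" "z \<in> U"
    using linear_onD(2)[OF lin[OF that(2)] that(1)] by simp
  show "b x y = b y x" if "x \<in> U" "y \<in> U"
    using sp[THEN conjunct2, THEN conjunct2, THEN conjunct1] that by (metis (no_types))
  show "nondegenerate_on U b"
    unfolding nondegenerate_on_def by (rule sp[THEN conjunct2, THEN conjunct2, THEN conjunct2])
qed

lemma admissible_family:
  "clifford_family (r + s) U (\<lambda>i. J (Poly_Mapping.single i 1)) (\<lambda>i. if i < r then 1 else -1) b"
proof (intro clifford_family.intro clifford_family_axioms.intro sym_form.intro)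
  let ?e = "\<lambda>i. Poly_Mapping.single i (1::real)"
  note e = single_in_Rspace
  fix i x assume i: "i < r + s" and x: "x \<in> U"
  note lin = admissible_moduleD(4)[OF e[OF i], unfolded linear_endo_on_def]
  show Jx: "J (?e i) x \<in> U" using lin x by blast
  show "J (?e i) (x + y) = J (?e i) x + J (?e i) y" if "y \<in> U" for y
    using lin linear_onD(1) x that by blast
  show "J (?e i) (c *\<^sub>R x) = c *\<^sub>R J (?e i) x" for c
    using lin linear_onD(2) x by blast
  show "J (?e i) (J (?e i) x) = - ((if i < r then 1 else - 1) *\<^sub>R x)"
    using admissible_moduleD(6)[OF e[OF i] x] sp_single[OF i, of "?e i"] by simp
  show "b (J (?e i) x) y = - b x (J (?e i) y)" if "y \<in> U" for y
    using admissible_moduleD(7)[OF e[OF i] x that] by simp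
  show "J (?e i) (J (?e j) x) = - J (?e j) (J (?e i) x)" if j: "j < r + s" and ij: "i \<noteq> j" for j
  proof -
    have eij: "?e i + ?e j \<in> Rspace r s"
      using subspace_add[OF subspace_Rspace e[OF i] e[OF j]] .
    have Jj: "J (?e j) x \<in> U"
      using admissible_moduleD(4)[OF e[OF j]] x by (auto simp: linear_endo_on_def)
    have add: "J (?e i + ?e j) y = J (?e i) y + J (?e j) y" if "y \<in> U" for y
      using linear_onD(1)[OF admissible_moduleD(5)[OF that] e[OF i] e[OF j]] .
    have lin': "J (?e k) (J (?e i) x + J (?e j) x) = J (?e k) (J (?e i) x) + J (?e k) (J (?e j) x)"
      if "k < r + s" for k
      using linear_onD(1)[OF _ Jx Jj] admissible_moduleD(4)[OF e[OF that]]
      by (auto simp: linear_endo_on_def)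
    have Jsum: "J (?e i) x + J (?e j) x \<in> U"
      using subspace_add[OF admissible_moduleD(2) Jx Jj] .
    \<comment> \<open>Polarisation: the square of \<open>J\<close> at a sum of two orthogonal basis
      vectors, compared with the two single squares, leaves the anticommutator.\<close>
    have "J (?e i) (J (?e i) x) + J (?e i) (J (?e j) x) + (J (?e j) (J (?e i) x) + J (?e j) (J (?e j) x))
        = J (?e i + ?e j) (J (?e i + ?e j) x)"
      by (simp only: add[OF x] add[OF Jsum] lin'[OF i] lin'[OF j])
    also have "\<dots> = - ((sp r s (?e i) (?e i) + sp r s (?e j) (?e j)) *\<^sub>R x)"
      unfolding admissible_moduleD(6)[OF eij x] sp_add_left sp_single[OF i] sp_single[OF j]
      using ij by (simp add: lookup_add lookup_single)
    also have "\<dots> = J (?e i) (J (?e i) x) + J (?e j) (J (?e j) x)"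
      unfolding admissible_moduleD(6)[OF e[OF i] x] admissible_moduleD(6)[OF e[OF j] x]
      by (simp add: scaleR_add_left)
    finally have "J (?e i) (J (?e j) x) + J (?e j) (J (?e i) x) = 0" by simp
    then show ?thesis by (simp add: add_eq_0_iff2)
  qed
qed (use admissible_moduleD(2) admissible_formD in auto)

lemma J_expand:
  assumes "z \<in> Rspace r s" "x \<in> U"
  shows "J z x = (\<Sum>i<r + s. Poly_Mapping.lookup z i *\<^sub>R J (Poly_Mapping.single i 1) x)"
  using linear_on_sum[OF admissible_moduleD(5)[OF assms(2)] subspace_Rspace, of "{..<r + s}"
      "\<lambda>i. Poly_Mapping.single i 1" "Poly_Mapping.lookup z"]
    Rspace_expand[OF assms(1)] single_in_Rspace by auto

lemma form_J_expand:
  assumes "z \<in> Rspace r s" "x \<in> U" "y \<in> U"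
  shows "b (J z x) y =
    (\<Sum>i<r + s. Poly_Mapping.lookup z i * b (J (Poly_Mapping.single i 1) x) y)"
proof -
  interpret clifford_family "r + s" U "\<lambda>i. J (Poly_Mapping.single i 1)" "\<lambda>i. if i < r then 1 else -1" b
    by (rule admissible_family)
  show ?thesis
    unfolding J_expand[OF assms(1,2)] using assms
    by (subst b_sum_left) (auto simp: E_closed b_scale_left)
qed

lemma admissible_submodule:
  assumes X: "subspace X" "X \<subseteq> U" "\<And>i. i < r + s \<Longrightarrow> J (Poly_Mapping.single i 1) ` X \<subseteq> X"
    and nd: "nondegenerate_on X b"
  shows "admissible_module r s X J b"
  unfolding admissible_module_def clifford_module_def
proof (intro conjI ballI)
  have XU: "x \<in> U" if "x \<in> X" for x using X(2) that by blast
  obtain F where F: "finite F" "span F = U"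
    using admissible_moduleD(1) unfolding finite_dim_subspace_def by blast
  obtain B where B: "B \<subseteq> X" "independent B" "X \<subseteq> span B"
    using basis_exists by metis
  have "B \<subseteq> span F" using B(1) X(2) F(2) by blast
  then have "finite B" using independent_span_bound[OF F(1) B(2)] by simp
  moreover have "span B = X" using B X(1) span_subspace by blast
  ultimately show "finite_dim_subspace X" using X(1) unfolding finite_dim_subspace_def by blast
  show "linear_endo_on X (J z)" if z: "z \<in> Rspace r s" for z
    unfolding linear_endo_on_def
  proof (intro conjI subsetI)
    have "linear_on U (J z)" using admissible_moduleD(4)[OF z] by (simp only: linear_endo_on_def)
    then show "linear_on X (J z)" by (rule linear_on_subset[OF _ X(2)])
    fix y assume "y \<in> J z ` X"
    then obtain x where x: "x \<in> X" "y = J z x" by blast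
    show "y \<in> X"
      unfolding x(2) J_expand[OF z XU[OF x(1)]]
      by (intro subspace_sum subspace_scale X(1)) (use X(3) x(1) in blast)
  qed
  note sp = admissible_moduleD(3)[unfolded scalar_product_on_def]
  show "scalar_product_on X b"
    unfolding scalar_product_on_def
  proof (intro conjI)
    show "\<forall>y\<in>X. linear_on X (\<lambda>x. b x y)"
    proof
      fix y assume y: "y \<in> X"
      show "linear_on X (\<lambda>x. b x y)"
        by (rule linear_on_subset[OF bspec[OF sp[THEN conjunct1] XU[OF y]] X(2)])
    qed
    show "\<forall>x\<in>X. linear_on X (\<lambda>y. b x y)"
    proof
      fix x assume x: "x \<in> X"
      show "linear_on X (\<lambda>y. b x y)"
        by (rule linear_on_subset[OF bspec[OF sp[THEN conjunct2, THEN conjunct1] XU[OF x]] X(2)])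
    qed
    show "\<forall>x\<in>X. \<forall>y\<in>X. b x y = b y x" using admissible_formD(3) XU by blast
    show "\<forall>x\<in>X. (\<forall>y\<in>X. b x y = 0) \<longrightarrow> x = 0" using nd by (simp only: nondegenerate_on_def)
  qed
  show "linear_on (Rspace r s) (\<lambda>z. J z x)" if "x \<in> X" for x
    by (rule admissible_moduleD(5)[OF XU[OF that]])
  show "J z (J z x) = - (sp r s z z *\<^sub>R x)" if "z \<in> Rspace r s" "x \<in> X" for z x
    by (rule admissible_moduleD(6)[OF that(1) XU[OF that(2)]])
  show "b (J z x) y + b x (J z y) = 0" if "z \<in> Rspace r s" "x \<in> X" "y \<in> X" for z x y
    by (rule admissible_moduleD(7)[OF that(1) XU[OF that(2)] XU[OF that(3)]])
qed

end

text \<open>A nonzero invariant subspace on which the form is nondegenerate is itself admissible,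
  and a proper one would have smaller dimension.\<close>

lemma minimal_admissible_simple:
  assumes "minimal_admissible r s U J b"
  shows "clifford_family.simple (r + s) U (\<lambda>i. J (Poly_Mapping.single i 1)) b"
proof -
  have adm: "admissible_module r s U J b" and U0: "U \<noteq> {0}"
    and min: "\<And>X. admissible_module r s X J b \<Longrightarrow> X \<noteq> {0} \<Longrightarrow> dim U \<le> dim X"
    using assms unfolding minimal_admissible_def by blast+
  interpret clifford_family "r + s" U "\<lambda>i. J (Poly_Mapping.single i 1)" "\<lambda>i. if i < r then 1 else -1" b
    by (rule admissible_family[OF adm])
  show ?thesis
    unfolding simple_def
  proof (intro conjI allI impI)
    show "U \<noteq> {0}" by fact
    show "nondegenerate_on U b" by (rule admissible_formD(4)[OF adm])
    fix X
    assume X: "subspace X \<and> X \<subseteq> U \<and> X \<noteq> {0} \<and>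
      (\<forall>i<r + s. J (Poly_Mapping.single i 1) ` X \<subseteq> X) \<and> nondegenerate_on X b"
    then have "dim U \<le> dim X" by (intro min admissible_submodule[OF adm]) auto
    obtain B where B: "B \<subseteq> X" "independent B" "X \<subseteq> span B" "card B = dim X"
      using basis_exists by blast
    obtain F where F: "finite F" "span F = U"
      using admissible_moduleD(1)[OF adm] by (auto simp: finite_dim_subspace_def)
    obtain C where C: "C \<subseteq> U" "independent C" "U \<subseteq> span C" "card C = dim U"
      using basis_exists by blast
    have fin: "finite B" "finite C"
      using independent_span_bound[OF F(1)] F(2) B(1,2) C(1,2) X by blast+
    have spB: "span B = X" using B X span_subspace by blast
    show "X = U"
    proof (rule ccontr)
      assume "X \<noteq> U"
      then obtain x where x: "x \<in> U" "x \<notin> span B" using X spB by blast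
      then have "independent (insert x B)" using B(2) by (simp add: independent_insert)
      moreover have "insert x B \<subseteq> span C" using x(1) B(1) X C(3) by blast
      ultimately have "card (insert x B) \<le> card C"
        using independent_span_bound[OF fin(2)] by blast
      moreover have "card (insert x B) = Suc (card B)"
        using x(2) fin(1) span_base by (intro card_insert_disjoint) auto
      ultimately show False using \<open>dim U \<le> dim X\<close> B(4) C(4) by simp
    qed
  qed
qed

section \<open>The map of the centre\<close>

definition coord_rev :: "nat \<Rightarrow> coords \<Rightarrow> coords" where
  "coord_rev n z = (\<Sum>i<n. Poly_Mapping.lookup z (n - Suc i) *\<^sub>R Poly_Mapping.single i 1)"

lemma lookup_coord_rev:
  "Poly_Mapping.lookup (coord_rev n z) k = (if k < n then Poly_Mapping.lookup z (n - Suc k) else 0)"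
proof -
  have "Poly_Mapping.lookup (coord_rev n z) k =
      (\<Sum>i<n. if k = i then Poly_Mapping.lookup z (n - Suc i) else 0)"
    unfolding coord_rev_def lookup_sum
    by (intro sum.cong) (auto simp: lookup_scaleR_coords lookup_single when_def)
  then show ?thesis by auto
qed

lemma coord_rev_linear: "linear (coord_rev n)"
  by (rule linearI)
    (auto intro!: poly_mapping_eqI simp: lookup_coord_rev lookup_add lookup_scaleR_coords)

lemma coord_rev_Rspace: "coord_rev (r + s) z \<in> Rspace r s"
  by (auto simp: Rspace_def in_keys_iff lookup_coord_rev split: if_splits)

lemma coord_rev_coord_rev: "z \<in> Rspace r s \<Longrightarrow> coord_rev (r + s) (coord_rev (r + s) z) = z"
  by (rule poly_mapping_eqI) (auto simp: lookup_coord_rev Rspace_def in_keys_iff subset_iff)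

lemma Rspace_commute: "Rspace r s = Rspace s r"
  by (simp add: Rspace_def add.commute)

text \<open>Reversal exchanges the first \<open>r\<close> coordinates with the last
  \<open>r\<close>, which are positive for \<open>(r, s)\<close> and negative for
  \<open>(s, r)\<close>; it is thus an anti-isometry.\<close>

lemma sp_coord_rev: "sp s r z (coord_rev (r + s) v) = - sp r s (coord_rev (r + s) z) v"
proof -
  let ?n = "r + s"
  define g where "g = (\<lambda>i. Poly_Mapping.lookup (coord_rev ?n z) i *
    ((if i < r then 1 else -1) * Poly_Mapping.lookup v i))"
  have "sp s r z (coord_rev ?n v) = (\<Sum>i<?n. - g (?n - Suc i))"
    unfolding sp_eq g_def
    by (intro sum.cong) (auto simp: lookup_coord_rev add.commute[of s r])
  also have "\<dots> = - (\<Sum>i<?n. g (?n - Suc i))" by (simp add: sum_negf)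
  also have "(\<Sum>i<?n. g (?n - Suc i)) = sum g {..<?n}" by (rule sum.nat_diff_reindex)
  also have "sum g {..<?n} = sp r s (coord_rev ?n z) v" by (simp add: sp_eq g_def)
  finally show ?thesis .
qed

lemma module_bracket_eqI:
  assumes "admissible_module r s U J b" "x \<in> U" "y \<in> U" "v \<in> Rspace r s"
    and "\<And>i. i < r + s \<Longrightarrow> b (J (Poly_Mapping.single i 1) x) y = sp r s (Poly_Mapping.single i 1) v"
  shows "module_bracket r s J b x y = v"
proof -
  have "b (J z x) y = sp r s z v" if z: "z \<in> Rspace r s" for z
    unfolding form_J_expand[OF assms(1) z assms(2,3)] sp_eq
    by (intro sum.cong) (auto simp: assms(5) sp_single)
  then show ?thesis
    unfolding module_bracket_def using module_bracket_ex1[OF assms(1-3)] assms(4)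
    by (intro the1_equality) auto
qed

lemma module_bracket:
  assumes "admissible_module r s U J b" "x \<in> U" "y \<in> U"
  shows "module_bracket r s J b x y \<in> Rspace r s"
    and "z \<in> Rspace r s \<Longrightarrow> b (J z x) y = sp r s z (module_bracket r s J b x y)"
  using theI'[OF module_bracket_ex1[OF assms]] unfolding module_bracket_def by blast+

text \<open>The assumption on \<open>A\<close> says that the i-th basis vector pairs with the
  bracket of the images as \<open>t\<close> times its mirror image pairs with the original bracket.
  The two scalar products give these basis vectors opposite signs, whence the factor
  \<open>- t\<close>.\<close>

lemma lie_isomorphism_reversing:
  assumes V: "admissible_module r s V J b" and W: "admissible_module s r W J' b'"
    and A: "linear_on V A" "bij_betw A V W" and t: "t = 1 \<or> t = (-1::real)"
    and AJ: "\<And>i x y. i < r + s \<Longrightarrow> x \<in> V \<Longrightarrow> y \<in> V \<Longrightarrow>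
      b' (J' (Poly_Mapping.single i 1) (A x)) (A y) =
      t * b (J (Poly_Mapping.single (r + s - Suc i) 1) x) y"
  shows "lie_isomorphism (pseudo_H r s V J b) (pseudo_H s r W J' b')
    (map_prod A (\<lambda>z. - t *\<^sub>R coord_rev (r + s) z))"
proof -
  let ?n = "r + s"
  define C where "C = (\<lambda>z. - t *\<^sub>R coord_rev ?n z)"
  have C_lin: "C (x + y) = C x + C y" "C (c *\<^sub>R x) = c *\<^sub>R C x" for x y c
    by (simp_all add: C_def linear_add[OF coord_rev_linear] linear_scale[OF coord_rev_linear]
        scaleR_right_distrib)
  have C_mem: "C z \<in> Rspace s r" for z
    unfolding C_def Rspace_commute[of s r]
    by (intro subspace_scale subspace_Rspace coord_rev_Rspace)
  have C_C: "C (C z) = z" if "z \<in> Rspace r s" for z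
    using t coord_rev_coord_rev[OF that]
    by (auto simp: C_def linear_scale[OF coord_rev_linear] linear_neg[OF coord_rev_linear])
  have "bij_betw C (Rspace r s) (Rspace s r)"
    by (rule bij_betw_byWitness[where f' = C]) (use C_C C_mem in \<open>auto simp: Rspace_commute[of s r]\<close>)
  then have bij: "bij_betw (map_prod A C) (V \<times> Rspace r s) (W \<times> Rspace s r)"
    using A(2) by (intro bij_betw_map_prod)
  have AW: "A x \<in> W" if "x \<in> V" for x using A(2) that by (auto simp: bij_betw_def)
  have A0: "A 0 = 0"
    using linear_onD(2)[OF A(1), of 0 0] subspace_0[OF admissible_moduleD(2)[OF V]] by simp
  have bracket: "C (module_bracket r s J b x y) = module_bracket s r J' b' (A x) (A y)"
    if x: "x \<in> V" and y: "y \<in> V" for x y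
  proof (rule sym, rule module_bracket_eqI[OF W AW[OF x] AW[OF y] C_mem])
    fix i assume "i < s + r"
    then have i: "i < r + s" and j: "?n - Suc i < ?n" by auto
    let ?v = "module_bracket r s J b x y"
    have "sp s r (Poly_Mapping.single i 1) (C ?v) =
        (if i < s then 1 else -1) * (- t * Poly_Mapping.lookup ?v (?n - Suc i))"
      using i by (simp add: sp_single add.commute[of s r] C_def lookup_scaleR_coords lookup_coord_rev)
    also have "\<dots> = t * sp r s (Poly_Mapping.single (?n - Suc i) 1) ?v"
      using i by (auto simp: sp_single[OF j])
    also have "\<dots> = b' (J' (Poly_Mapping.single i 1) (A x)) (A y)"
      using AJ[OF i x y] module_bracket(2)[OF V x y single_in_Rspace[OF j]] by simp
    finally show "b' (J' (Poly_Mapping.single i 1) (A x)) (A y) =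
        sp s r (Poly_Mapping.single i 1) (C ?v)" by simp
  qed
  show ?thesis
    unfolding lie_isomorphism_def pseudo_H_def lie_algebra.simps C_def[symmetric]
  proof (intro conjI)
    show "linear_on (V \<times> Rspace r s) (map_prod A C)"
      using linear_onD[OF A(1)] by (auto simp: linear_on_def C_lin)
    show "\<forall>p\<in>V \<times> Rspace r s. \<forall>q\<in>V \<times> Rspace r s.
      map_prod A C ((\<lambda>(x, z) (y, w). (0, module_bracket r s J b x y)) p q) =
      (\<lambda>(x, z) (y, w). (0, module_bracket s r J' b' x y)) (map_prod A C p) (map_prod A C q)"
      using bracket by (auto simp: A0)
  qed (rule bij)
qed

text \<open>The case \<open>l = 0\<close>, where the twist is empty, covers neutral signature; there
  both modules may be the same, which yields an automorphism.\<close>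

lemma minimal_admissible_reversing:
  fixes V :: "'v::real_vector set" and W :: "'w::real_vector set"
  assumes V: "minimal_admissible p q V J b" and W: "minimal_admissible q p W J' b'"
    and pq: "q = p + 8 * l" and m: "(p + 4 * l) mod 4 \<noteq> 3"
  obtains A t where "linear_on V A" "bij_betw A V W" "t = 1 \<or> t = (-1::real)"
    "lie_isomorphism (pseudo_H p q V J b) (pseudo_H q p W J' b')
      (map_prod A (\<lambda>z. - t *\<^sub>R coord_rev (p + q) z))"
proof -
  \<comment> \<open>In \<open>W\<close> the last \<open>4 l\<close> positive directions become
    negative; in \<open>V\<close> their mirror images, the first \<open>4 l\<close> negative
    directions, become positive. Either way the first \<open>?m\<close> directions end up positive
    and the rest negative.\<close>
  let ?m = "p + 4 * l" and ?Ns = "[p + 4 * l..<p + 8 * l]"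
  let ?E = "\<lambda>i. J (Poly_Mapping.single i 1)" and ?F = "\<lambda>i. J' (Poly_Mapping.single i 1)"
  have adm: "admissible_module p q V J b" "admissible_module q p W J' b'"
    using V W by (simp_all add: minimal_admissible_def)
  have n: "p + q = 2 * ?m" "q + p = 2 * ?m" using pq by simp_all
  have FV: "flipped_family (2 * ?m) V ?E (\<lambda>i. if i < p then 1 else -1) b
      (map (\<lambda>i. 2 * ?m - Suc i) ?Ns) (-1)"
    unfolding flipped_family_def flipped_family_axioms_def
    using admissible_family[OF adm(1)] n by (auto simp: distinct_map intro!: inj_onI)
  have FW: "flipped_family (2 * ?m) W ?F (\<lambda>i. if i < q then 1 else -1) b' ?Ns 1"
    unfolding flipped_family_def flipped_family_axioms_def
    using admissible_family[OF adm(2)] n pq by auto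
  have sV: "clifford_family.simple (2 * ?m) V ?E b"
    using minimal_admissible_simple[OF V] n by simp
  have sW: "clifford_family.simple (2 * ?m) W ?F b'"
    using minimal_admissible_simple[OF W] n by simp
  obtain A t where A: "linear_on V A" "bij_betw A V W" "t = 1 \<or> t = (-1::real)"
    "\<And>i x y. i < 2 * ?m \<Longrightarrow> x \<in> V \<Longrightarrow> y \<in> V \<Longrightarrow>
      b' (?F i (A x)) (A y) = t * b (?E (2 * ?m - Suc i) x) y"
    by (rule reversing_similarity[OF FV FW sV sW _ _ m])
      (use pq in \<open>auto intro: that\<close>)
  show thesis
    by (rule that[OF A(1-3)], rule lie_isomorphism_reversing[OF adm A(1-3)])
      (use A(4) n in auto)
qed

theorem theorem8:
  fixes r k :: nat
  assumes "r \<in> {1, 2, 4}" and "k \<ge> 1"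
  shows "(\<forall>(V :: 'v::real_vector set) J b (W :: 'w::real_vector set) J' b'.
            minimal_admissible r (r + 8 * k) V J b \<longrightarrow>
            minimal_admissible (r + 8 * k) r W J' b' \<longrightarrow>
            lie_isomorphic (pseudo_H r (r + 8 * k) V J b) (pseudo_H (r + 8 * k) r W J' b'))
       \<and> (\<forall>(U :: 'u::real_vector set) J b.
            minimal_admissible (r + 4 * k) (r + 4 * k) U J b \<longrightarrow>
            (\<exists>A C C\<tau>.
               linear_endo_on U A \<and>
               linear_endo_on (Rspace (r + 4 * k) (r + 4 * k)) C \<and>
               lie_automorphism (pseudo_H (r + 4 * k) (r + 4 * k) U J b) (map_prod A C) \<and>
               is_sp_adjoint (r + 4 * k) (r + 4 * k) C C\<tau> \<and>
               (\<forall>z \<in> Rspace (r + 4 * k) (r + 4 * k). C (C\<tau> z) = - z)))"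
proof (intro conjI allI impI)
  have m: "(r + 4 * k) mod 4 \<noteq> 3" using assms(1) by auto
  fix V :: "'v set" and W :: "'w set" and J b J' b'
  assume "minimal_admissible r (r + 8 * k) V J b" "minimal_admissible (r + 8 * k) r W J' b'"
  from minimal_admissible_reversing[OF this refl m]
  show "lie_isomorphic (pseudo_H r (r + 8 * k) V J b) (pseudo_H (r + 8 * k) r W J' b')"
    unfolding lie_isomorphic_def by metis
next
  let ?m = "r + 4 * k"
  have m: "(?m + 4 * 0) mod 4 \<noteq> 3" using assms(1) by auto
  fix U :: "'u set" and J b
  assume U: "minimal_admissible ?m ?m U J b"
  obtain A t where A: "linear_on U A" "bij_betw A U U" and t: "t = 1 \<or> t = (-1::real)"
    and iso: "lie_isomorphism (pseudo_H ?m ?m U J b) (pseudo_H ?m ?m U J b)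
      (map_prod A (\<lambda>z. - t *\<^sub>R coord_rev (?m + ?m) z))"
    by (rule minimal_admissible_reversing[OF U U _ m]) (simp, rule that)
  let ?C = "\<lambda>c z. c *\<^sub>R coord_rev (?m + ?m) z"
  have C: "linear_endo_on (Rspace ?m ?m) (?C c)" for c
    unfolding linear_endo_on_def linear_on_def
    using coord_rev_Rspace[of ?m ?m] subspace_scale[OF subspace_Rspace]
    by (auto simp: linear_add[OF coord_rev_linear] linear_scale[OF coord_rev_linear]
        scaleR_right_distrib)
  have sp_scale: "sp ?m ?m (c *\<^sub>R x) y = c * sp ?m ?m x y" "sp ?m ?m x (c *\<^sub>R y) = c * sp ?m ?m x y"
    for c x y
    by (simp_all add: sp_eq lookup_scaleR_coords sum_distrib_left mult_ac)
  show "\<exists>A C C\<tau>. linear_endo_on U A \<and> linear_endo_on (Rspace ?m ?m) C \<and>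
      lie_automorphism (pseudo_H ?m ?m U J b) (map_prod A C) \<and> is_sp_adjoint ?m ?m C C\<tau> \<and>
      (\<forall>z \<in> Rspace ?m ?m. C (C\<tau> z) = - z)"
  proof (intro exI conjI ballI)
    show "linear_endo_on U A" using A by (auto simp: linear_endo_on_def bij_betw_def)
    show "linear_endo_on (Rspace ?m ?m) (?C (- t))" by (rule C)
    show "lie_automorphism (pseudo_H ?m ?m U J b) (map_prod A (?C (- t)))"
      using iso by (simp add: lie_automorphism_def)
    \<comment> \<open>In neutral signature coordinate reversal is an involution equal to minus its
      own adjoint. So the adjoint of \<open>- t\<close> times it is \<open>t\<close> times it, and
      the product of the two is minus the identity since \<open>t * t = 1\<close>.\<close>
    show "is_sp_adjoint ?m ?m (?C (- t)) (?C t)"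
      unfolding is_sp_adjoint_def
      using C[of t] sp_coord_rev[of ?m ?m] by (simp add: sp_scale del: scaleR_minus_left mult_2)
    show "?C (- t) (?C t z) = - z" if "z \<in> Rspace ?m ?m" for z
      using t coord_rev_coord_rev[OF that]
      by (auto simp: linear_scale[OF coord_rev_linear] linear_neg[OF coord_rev_linear])
  qed
qed

end
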